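(* Let $V_1, V_2$ be real vector spaces with a bilinear pairing $\langle\,,\,\rangle\colon V_1\times V_2\to\mathbb{R}$, let $S$ be an indexing set, and let $\Pi_1=\{\alpha_s\mid s\in S\}\subseteq V_1$ and $\Pi_2=\{\beta_s\mid s\in S\}\subseteq V_2$ both be in bijective correspondence with $S$. Suppose that $\langle\alpha_s,\beta_s\rangle=1$ for all $s\in S$; that $0\notin\mathrm{PLC}(\Pi_1)$ and $0\notin\mathrm{PLC}(\Pi_2)$; and that $\alpha_s\notin\mathrm{PLC}(\Pi_1\setminus\{\alpha_s\})$ and $\beta_s\notin\mathrm{PLC}(\Pi_2\setminus\{\beta_s\})$ for each $s\in S$. Let $(W,R)$ be the Coxeter system in which $W$ is the abstract group generated by a set of involutions $R=\{r_s\mid s\in S\}$ subject only to the condition that, for distinct $s,t\in S$, the order of $r_sr_t$ is $m$ if $\langle\alpha_s,\beta_t\rangle\langle\alpha_t,\beta_s\rangle=\cos^2(\pi/m)$ for an integer $m\ge 2$, and is infinite otherwise. If $\Phi_1=\Phi_1^+\uplus\Phi_1^-$, or equivalently $\Phi_2=\Phi_2^+\uplus\Phi_2^-$ (disjoint unions), then there exist group isomorphisms $f_1\colon W\to W_1$ and $f_2\colon W\to W_2$ such that $f_1(r_s)=\rho_1(s)$ and $f_2(r_s)=\rho_2(s)$ for all $s\in S$.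
   Context: For a subset $A$ of a real vector space, $\mathrm{PLC}(A)$ is the set of all (finite) linear combinations $\sum_{a\in A}c_a a$ with all $c_a\ge 0$ and at least one $c_{a'}>0$. For $s\in S$ define $\rho_1(s)\in\mathrm{GL}(V_1)$ and $\rho_2(s)\in\mathrm{GL}(V_2)$ by $\rho_1(s)(x)=x-2\langle x,\beta_s\rangle\alpha_s$ for $x\in V_1$ and $\rho_2(s)(y)=y-2\langle\alpha_s,y\rangle\beta_s$ for $y\in V_2$. For $i\in\{1,2\}$: $W_i=\langle\rho_i(s)\mid s\in S\rangle\le \mathrm{GL}(V_i)$; $\Phi_i=W_i\Pi_i$; $\Phi_i^+=\Phi_i\cap\mathrm{PLC}(\Pi_i)$; $\Phi_i^-=-\Phi_i^+$. *)

theory Defs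
  imports "HOL-Analysis.Analysis" "HOL-Algebra.Generated_Groups"
begin

section \<open>Groups given by generators and relators\<close>

text \<open>A letter \<open>(s, True)\<close> stands for the generator \<open>s\<close> and \<open>(s, False)\<close> for its formal inverse.
  Two words over \<open>S\<close> are related iff they are equal in the free group on \<open>S\<close> modulo the normal
  closure of the relators.\<close>

type_synonym 's gword = "('s \<times> bool) list"

abbreviation gwords :: "'s set \<Rightarrow> 's gword set"
  where "gwords S \<equiv> lists (S \<times> UNIV)"

inductive_set pres_rel :: "'s set \<Rightarrow> 's gword set \<Rightarrow> ('s gword \<times> 's gword) set"
  for S :: "'s set" and Rel :: "'s gword set" where
  refl: "u \<in> gwords S \<Longrightarrow> (u, u) \<in> pres_rel S Rel"
| sym: "(u, v) \<in> pres_rel S Rel \<Longrightarrow> (v, u) \<in> pres_rel S Rel"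
| trans: "(u, v) \<in> pres_rel S Rel \<Longrightarrow> (v, w) \<in> pres_rel S Rel \<Longrightarrow> (u, w) \<in> pres_rel S Rel"
| append: "(u, u') \<in> pres_rel S Rel \<Longrightarrow> (v, v') \<in> pres_rel S Rel
    \<Longrightarrow> (u @ v, u' @ v') \<in> pres_rel S Rel"
| cancel: "s \<in> S \<Longrightarrow> ([(s, b), (s, \<not> b)], []) \<in> pres_rel S Rel"
| relator: "u \<in> Rel \<Longrightarrow> u \<in> gwords S \<Longrightarrow> (u, []) \<in> pres_rel S Rel"

definition pres_class :: "'s set \<Rightarrow> 's gword set \<Rightarrow> 's gword \<Rightarrow> 's gword set"
  where "pres_class S Rel u = pres_rel S Rel `` {u}"

definition presented_group :: "'s set \<Rightarrow> 's gword set \<Rightarrow> 's gword set monoid" where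
  "presented_group S Rel =
    \<lparr>carrier = gwords S // pres_rel S Rel,
     mult = (\<lambda>A B. \<Union>u\<in>A. \<Union>v\<in>B. pres_class S Rel (u @ v)),
     one = pres_class S Rel []\<rparr>"

definition pres_gen :: "'s set \<Rightarrow> 's gword set \<Rightarrow> 's \<Rightarrow> 's gword set"
  where "pres_gen S Rel s = pres_class S Rel [(s, True)]"

lemma pres_rel_gwords:
  assumes "(u, v) \<in> pres_rel S Rel"
  shows "u \<in> gwords S \<and> v \<in> gwords S"
  using assms by induction auto

lemma equiv_pres_rel: "equiv (gwords S) (pres_rel S Rel)"
proof (rule equivI)
  show "pres_rel S Rel \<subseteq> gwords S \<times> gwords S"
    using pres_rel_gwords by fast
  show "refl_on (gwords S) (pres_rel S Rel)"
    by (rule refl_onI) (rule pres_rel.refl)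
  show "sym (pres_rel S Rel)"
    by (rule symI) (rule pres_rel.sym)
  show "trans (pres_rel S Rel)"
    by (rule transI) (rule pres_rel.trans)
qed

lemma pres_class_eq_iff:
  assumes "u \<in> gwords S" "v \<in> gwords S"
  shows "pres_class S Rel u = pres_class S Rel v \<longleftrightarrow> (u, v) \<in> pres_rel S Rel"
  unfolding pres_class_def using eq_equiv_class_iff[OF equiv_pres_rel assms] .

lemma carrier_presented_group: "carrier (presented_group S Rel) = pres_class S Rel ` gwords S"
  by (auto simp: presented_group_def quotient_def pres_class_def)

lemma one_presented_group: "\<one>\<^bsub>presented_group S Rel\<^esub> = pres_class S Rel []"
  by (simp add: presented_group_def)

lemma mult_presented_group:
  assumes "u \<in> gwords S" "v \<in> gwords S"
  shows "pres_class S Rel u \<otimes>\<^bsub>presented_group S Rel\<^esub> pres_class S Rel v = pres_class S Rel (u @ v)"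
proof -
  have *: "pres_class S Rel (u' @ v') = pres_class S Rel (u @ v)"
    if "u' \<in> pres_class S Rel u" "v' \<in> pres_class S Rel v" for u' v'
  proof -
    have "(u, u') \<in> pres_rel S Rel" "(v, v') \<in> pres_rel S Rel"
      using that by (auto simp: pres_class_def)
    then have "(u' @ v', u @ v) \<in> pres_rel S Rel"
      by (rule pres_rel.sym[OF pres_rel.append])
    moreover from this have "u' @ v' \<in> gwords S" "u @ v \<in> gwords S"
      by (auto dest!: pres_rel_gwords)
    ultimately show ?thesis
      by (simp only: pres_class_eq_iff)
  qed
  have "u \<in> pres_class S Rel u" "v \<in> pres_class S Rel v"
    using assms by (simp_all only: pres_class_def Image_singleton_iff pres_rel.refl)
  then have "(\<Union>u'\<in>pres_class S Rel u. \<Union>v'\<in>pres_class S Rel v. pres_class S Rel (u' @ v')) =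
      pres_class S Rel (u @ v)"
    using * by blast
  then show ?thesis
    by (simp add: presented_group_def)
qed

lemma pres_rel_left_inverse:
  assumes "u \<in> gwords S"
  shows "\<exists>v\<in>gwords S. (v @ u, []) \<in> pres_rel S Rel"
  using assms
proof (induction u)
  case Nil
  then show ?case by (auto intro: pres_rel.refl)
next
  case (Cons x u)
  obtain s b where x: "x = (s, b)" by (cases x)
  then have s: "s \<in> S" using Cons by auto
  from Cons obtain v where v: "v \<in> gwords S" "(v @ u, []) \<in> pres_rel S Rel" by auto
  have "([(s, \<not> b), (s, b)], []) \<in> pres_rel S Rel"
    using pres_rel.cancel[OF s, of "\<not> b"] by simp
  moreover have "(u, u) \<in> pres_rel S Rel"
    using Cons by (intro pres_rel.refl) auto
  ultimately have "([(s, \<not> b), (s, b)] @ u, [] @ u) \<in> pres_rel S Rel"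
    by (rule pres_rel.append)
  with pres_rel.refl[OF v(1)]
  have "(v @ ([(s, \<not> b), (s, b)] @ u), v @ ([] @ u)) \<in> pres_rel S Rel"
    by (rule pres_rel.append)
  then have "(v @ ([(s, \<not> b), (s, b)] @ u), []) \<in> pres_rel S Rel"
    unfolding append_Nil using v(2) by (rule pres_rel.trans)
  then have "((v @ [(s, \<not> b)]) @ x # u, []) \<in> pres_rel S Rel"
    using x by simp
  moreover have "v @ [(s, \<not> b)] \<in> gwords S"
    using v s by auto
  ultimately show ?case by blast
qed

lemma group_presented_group: "group (presented_group S Rel)"
proof (rule groupI)
  show "\<one>\<^bsub>presented_group S Rel\<^esub> \<in> carrier (presented_group S Rel)"
    by (auto simp: carrier_presented_group one_presented_group)
next
  fix x assume "x \<in> carrier (presented_group S Rel)"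
  then obtain u where u: "u \<in> gwords S" "x = pres_class S Rel u"
    by (auto simp only: carrier_presented_group)
  then show "\<one>\<^bsub>presented_group S Rel\<^esub> \<otimes>\<^bsub>presented_group S Rel\<^esub> x = x"
    by (simp add: one_presented_group mult_presented_group)
  obtain v where v: "v \<in> gwords S" "(v @ u, []) \<in> pres_rel S Rel"
    using pres_rel_left_inverse u(1) by blast
  then have "pres_class S Rel v \<otimes>\<^bsub>presented_group S Rel\<^esub> x = \<one>\<^bsub>presented_group S Rel\<^esub>"
    using u by (simp add: one_presented_group mult_presented_group pres_class_eq_iff)
  then show "\<exists>y\<in>carrier (presented_group S Rel). y \<otimes>\<^bsub>presented_group S Rel\<^esub> x = \<one>\<^bsub>presented_group S Rel\<^esub>"
    using v(1) by (auto simp only: carrier_presented_group)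
next
  fix x y assume "x \<in> carrier (presented_group S Rel)" "y \<in> carrier (presented_group S Rel)"
  then obtain u v where uv: "u \<in> gwords S" "v \<in> gwords S"
      "x = pres_class S Rel u" "y = pres_class S Rel v"
    by (auto simp only: carrier_presented_group)
  then have "x \<otimes>\<^bsub>presented_group S Rel\<^esub> y = pres_class S Rel (u @ v)"
    by (simp only: mult_presented_group)
  moreover have "u @ v \<in> gwords S" using uv by auto
  ultimately show "x \<otimes>\<^bsub>presented_group S Rel\<^esub> y \<in> carrier (presented_group S Rel)"
    by (simp only: carrier_presented_group imageI)
  fix z assume "z \<in> carrier (presented_group S Rel)"
  then obtain w where w: "w \<in> gwords S" "z = pres_class S Rel w"
    by (auto simp only: carrier_presented_group)
  have "u @ v \<in> gwords S" "v @ w \<in> gwords S" using uv w by auto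
  then show "x \<otimes>\<^bsub>presented_group S Rel\<^esub> y \<otimes>\<^bsub>presented_group S Rel\<^esub> z =
      x \<otimes>\<^bsub>presented_group S Rel\<^esub> (y \<otimes>\<^bsub>presented_group S Rel\<^esub> z)"
    using uv w by (simp only: mult_presented_group append_assoc)
qed

fun gword_eval :: "('g, 'b) monoid_scheme \<Rightarrow> ('s \<Rightarrow> 'g) \<Rightarrow> 's gword \<Rightarrow> 'g" where
  "gword_eval G f [] = \<one>\<^bsub>G\<^esub>"
| "gword_eval G f ((s, b) # u) = (if b then f s else inv\<^bsub>G\<^esub> f s) \<otimes>\<^bsub>G\<^esub> gword_eval G f u"

lemma gword_eval_closed:
  assumes "group G" "f \<in> S \<rightarrow> carrier G" "u \<in> gwords S"
  shows "gword_eval G f u \<in> carrier G"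
proof -
  interpret group G by fact
  show ?thesis
    using assms(3)
  proof (induction u)
    case (Cons x u)
    then show ?case using assms(2) by (cases x) auto
  qed simp
qed

lemma gword_eval_append:
  assumes "group G" "f \<in> S \<rightarrow> carrier G" "u \<in> gwords S" "v \<in> gwords S"
  shows "gword_eval G f (u @ v) = gword_eval G f u \<otimes>\<^bsub>G\<^esub> gword_eval G f v"
proof -
  interpret group G by fact
  show ?thesis
    using assms(3)
  proof (induction u)
    case Nil
    then show ?case using gword_eval_closed[OF assms(1,2,4)] by simp
  next
    case (Cons x u)
    obtain s b where x: "x = (s, b)" by (cases x)
    have "f s \<in> carrier G" using assms(2) Cons x by auto
    then show ?case
      using Cons x gword_eval_closed[OF assms(1,2)] assms(4) by (auto simp: m_assoc)
  qed
qed

theorem presented_group_universal: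
  assumes G: "group G" and f: "f \<in> S \<rightarrow> carrier G"
    and rel: "\<And>u. u \<in> Rel \<Longrightarrow> u \<in> gwords S \<Longrightarrow> gword_eval G f u = \<one>\<^bsub>G\<^esub>"
  shows "\<exists>h\<in>hom (presented_group S Rel) G. \<forall>s\<in>S. h (pres_gen S Rel s) = f s"
proof -
  interpret group G by fact
  have eq: "gword_eval G f u = gword_eval G f v" if "(u, v) \<in> pres_rel S Rel" for u v
    using that
  proof induction
    case (append u u' v v')
    then show ?case
      using gword_eval_append[OF G f] pres_rel_gwords[OF append.hyps(1)]
        pres_rel_gwords[OF append.hyps(2)] by simp
  next
    case (cancel s b)
    then have "f s \<in> carrier G" using f by auto
    then show ?case by simp
  qed (use rel in auto)
  define h where "h A = gword_eval G f (SOME u. u \<in> A)" for A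
  have h: "h (pres_class S Rel u) = gword_eval G f u" if "u \<in> gwords S" for u
  proof -
    have "u \<in> pres_class S Rel u"
      using that by (auto simp: pres_class_def intro: pres_rel.refl)
    then have "(SOME v. v \<in> pres_class S Rel u) \<in> pres_class S Rel u"
      by (rule someI)
    then show ?thesis
      using eq by (auto simp: h_def pres_class_def)
  qed
  have "h \<in> hom (presented_group S Rel) G"
  proof (rule homI)
    fix x assume "x \<in> carrier (presented_group S Rel)"
    then obtain u where u: "u \<in> gwords S" "x = pres_class S Rel u"
      by (auto simp only: carrier_presented_group)
    then show "h x \<in> carrier G"
      by (simp only: h gword_eval_closed[OF G f])
    fix y assume "y \<in> carrier (presented_group S Rel)"
    then obtain v where v: "v \<in> gwords S" "y = pres_class S Rel v"
      by (auto simp only: carrier_presented_group)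
    have "u @ v \<in> gwords S" using u v by auto
    then show "h (x \<otimes>\<^bsub>presented_group S Rel\<^esub> y) = h x \<otimes>\<^bsub>G\<^esub> h y"
      using u v by (simp only: h mult_presented_group gword_eval_append[OF G f])
  qed
  moreover have "h (pres_gen S Rel s) = f s" if "s \<in> S" for s
  proof -
    have "f s \<in> carrier G" using f that by auto
    then show ?thesis using that h[of "[(s, True)]"] by (simp add: pres_gen_def)
  qed
  ultimately show ?thesis by blast
qed


section \<open>The abstract Coxeter group\<close>

text \<open>Since \<open>m \<mapsto> cos\<^sup>2(\<pi>/m)\<close> is injective on the integers \<open>m \<ge> 2\<close>, at most one \<open>m\<close> contributes a
  relator for each pair \<open>s \<noteq> t\<close>; if there is none, no relation is imposed on \<open>r\<^sub>s r\<^sub>t\<close>.\<close>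

definition coxeter_relators ::
    "'s set \<Rightarrow> ('v \<Rightarrow> 'w \<Rightarrow> real) \<Rightarrow> ('s \<Rightarrow> 'v) \<Rightarrow> ('s \<Rightarrow> 'w) \<Rightarrow> 's gword set" where
  "coxeter_relators S p \<alpha> \<beta> =
    {[(s, True), (s, True)] | s. s \<in> S} \<union>
    {concat (replicate m [(s, True), (t, True)]) | s t m.
      s \<in> S \<and> t \<in> S \<and> s \<noteq> t \<and> 2 \<le> m \<and> p (\<alpha> s) (\<beta> t) * p (\<alpha> t) (\<beta> s) = (cos (pi / real m))\<^sup>2}"

definition coxeter_group ::
    "'s set \<Rightarrow> ('v \<Rightarrow> 'w \<Rightarrow> real) \<Rightarrow> ('s \<Rightarrow> 'v) \<Rightarrow> ('s \<Rightarrow> 'w) \<Rightarrow> 's gword set monoid" where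
  "coxeter_group S p \<alpha> \<beta> = presented_group S (coxeter_relators S p \<alpha> \<beta>)"

definition coxeter_gen ::
    "'s set \<Rightarrow> ('v \<Rightarrow> 'w \<Rightarrow> real) \<Rightarrow> ('s \<Rightarrow> 'v) \<Rightarrow> ('s \<Rightarrow> 'w) \<Rightarrow> 's \<Rightarrow> 's gword set" where
  "coxeter_gen S p \<alpha> \<beta> s = pres_gen S (coxeter_relators S p \<alpha> \<beta>) s"


section \<open>Reflection groups and root systems\<close>

definition PLC :: "'v::real_vector set \<Rightarrow> 'v set" where
  "PLC A = {(\<Sum>a\<in>F. c a *\<^sub>R a) | F c.
    finite F \<and> F \<subseteq> A \<and> (\<forall>a\<in>F. 0 \<le> c a) \<and> (\<exists>a\<in>F. 0 < c a)}"

definition GL :: "('v::real_vector \<Rightarrow> 'v) monoid" where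
  "GL = \<lparr>carrier = {f. linear f \<and> bij f}, mult = (\<circ>), one = id\<rparr>"

lemma group_GL: "group (GL :: ('v::real_vector \<Rightarrow> 'v) monoid)"
proof (rule groupI)
  fix f :: "'v \<Rightarrow> 'v" assume "f \<in> carrier GL"
  then have f: "linear f" "bij f" by (auto simp: GL_def)
  obtain g where g: "linear g" "g \<circ> f = id"
    using linear_injective_left_inverse f bij_is_inj by metis
  then have "g = inv_into UNIV f"
    using f(2) by (metis bij_is_surj surj_imp_inv_eq comp_apply id_apply bij_is_inj)
  then have "g \<in> carrier GL" "g \<otimes>\<^bsub>GL\<^esub> f = \<one>\<^bsub>GL\<^esub>"
    using f g bij_imp_bij_inv by (auto simp: GL_def)
  then show "\<exists>g\<in>carrier GL. g \<otimes>\<^bsub>GL\<^esub> f = \<one>\<^bsub>GL\<^esub>" by blast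
qed (auto simp: GL_def linear_compose bij_comp o_assoc intro: linearI)

definition rho1 ::
    "('v::real_vector \<Rightarrow> 'w::real_vector \<Rightarrow> real) \<Rightarrow> ('s \<Rightarrow> 'v) \<Rightarrow> ('s \<Rightarrow> 'w) \<Rightarrow> 's \<Rightarrow> 'v \<Rightarrow> 'v"
  where "rho1 p \<alpha> \<beta> s = (\<lambda>x. x - (2 * p x (\<beta> s)) *\<^sub>R \<alpha> s)"

definition rho2 ::
    "('v::real_vector \<Rightarrow> 'w::real_vector \<Rightarrow> real) \<Rightarrow> ('s \<Rightarrow> 'v) \<Rightarrow> ('s \<Rightarrow> 'w) \<Rightarrow> 's \<Rightarrow> 'w \<Rightarrow> 'w"
  where "rho2 p \<alpha> \<beta> s = (\<lambda>y. y - (2 * p (\<alpha> s) y) *\<^sub>R \<beta> s)"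

text \<open>\<^const>\<open>subgroup_generated\<close> silently discards elements outside the ambient group;
  the next two lemmas show that nothing is discarded for the reflections.\<close>

lemma rho1_in_GL:
  assumes p: "bilinear p" and 1: "p (\<alpha> s) (\<beta> s) = 1"
  shows "rho1 p \<alpha> \<beta> s \<in> carrier GL"
proof -
  have "linear (rho1 p \<alpha> \<beta> s)"
    by (rule linearI)
      (simp_all add: rho1_def bilinear_ladd[OF p] bilinear_lmul[OF p] algebra_simps)
  moreover have "rho1 p \<alpha> \<beta> s \<circ> rho1 p \<alpha> \<beta> s = id"
    by (rule ext) (simp add: rho1_def bilinear_lsub[OF p] bilinear_lmul[OF p] 1 algebra_simps)
  ultimately show ?thesis
    by (simp add: GL_def o_bij)
qed

lemma rho2_in_GL:
  assumes p: "bilinear p" and 1: "p (\<alpha> s) (\<beta> s) = 1"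
  shows "rho2 p \<alpha> \<beta> s \<in> carrier GL"
proof -
  have "linear (rho2 p \<alpha> \<beta> s)"
    by (rule linearI)
      (simp_all add: rho2_def bilinear_radd[OF p] bilinear_rmul[OF p] algebra_simps)
  moreover have "rho2 p \<alpha> \<beta> s \<circ> rho2 p \<alpha> \<beta> s = id"
    by (rule ext) (simp add: rho2_def bilinear_rsub[OF p] bilinear_rmul[OF p] 1 algebra_simps)
  ultimately show ?thesis
    by (simp add: GL_def o_bij)
qed

definition refl_group :: "'s set \<Rightarrow> ('s \<Rightarrow> 'v::real_vector \<Rightarrow> 'v) \<Rightarrow> ('v \<Rightarrow> 'v) monoid" where
  "refl_group S \<rho> = subgroup_generated GL (\<rho> ` S)"

definition roots :: "'s set \<Rightarrow> ('s \<Rightarrow> 'v::real_vector \<Rightarrow> 'v) \<Rightarrow> ('s \<Rightarrow> 'v) \<Rightarrow> 'v set" where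
  "roots S \<rho> \<gamma> = {w v | w v. w \<in> carrier (refl_group S \<rho>) \<and> v \<in> \<gamma> ` S}"

definition pos_roots :: "'s set \<Rightarrow> ('s \<Rightarrow> 'v::real_vector \<Rightarrow> 'v) \<Rightarrow> ('s \<Rightarrow> 'v) \<Rightarrow> 'v set" where
  "pos_roots S \<rho> \<gamma> = roots S \<rho> \<gamma> \<inter> PLC (\<gamma> ` S)"

definition neg_roots :: "'s set \<Rightarrow> ('s \<Rightarrow> 'v::real_vector \<Rightarrow> 'v) \<Rightarrow> ('s \<Rightarrow> 'v) \<Rightarrow> 'v set" where
  "neg_roots S \<rho> \<gamma> = uminus ` pos_roots S \<rho> \<gamma>"

definition roots_split :: "'s set \<Rightarrow> ('s \<Rightarrow> 'v::real_vector \<Rightarrow> 'v) \<Rightarrow> ('s \<Rightarrow> 'v) \<Rightarrow> bool" where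
  "roots_split S \<rho> \<gamma> \<longleftrightarrow>
    roots S \<rho> \<gamma> = pos_roots S \<rho> \<gamma> \<union> neg_roots S \<rho> \<gamma> \<and>
    pos_roots S \<rho> \<gamma> \<inter> neg_roots S \<rho> \<gamma> = {}"

end

theory Submission
  imports Defs
begin

text \<open>The splitting of either root system is equivalent to a condition on the pairing that is
  symmetric in the two spaces: for \<open>s \<noteq> t\<close> the numbers \<open>p (\<alpha> s) (\<beta> t)\<close> and \<open>p (\<alpha> t) (\<beta> s)\<close> are
  nonpositive, vanish together, and have a product \<open>c\<^sup>2\<close> with \<open>c \<ge> 1\<close> or \<open>c = cos (\<pi>/m)\<close>. After
  rescaling \<open>\<alpha> t\<close>, the dihedral group of \<open>s\<close> and \<open>t\<close> moves \<open>\<alpha> s\<close> through combinations of \<open>\<alpha> s\<close>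
  and \<open>\<alpha> t\<close> whose coefficients are consecutive Chebyshev values \<open>sin (j\<theta>) / sin \<theta>\<close>; if \<open>\<pi>\<close> is not
  a multiple of \<open>\<theta>\<close>, some root has coefficients of opposite signs, which is impossible as
  \<open>\<alpha> s\<close> and \<open>\<alpha> t\<close> are extremal. Conversely, the condition yields the Coxeter relations, and
  Deodhar's induction on the length of \<open>w\<close> shows that \<open>w (\<alpha> s)\<close> is positive if \<open>w s\<close> is longer
  than \<open>w\<close>. It only uses expansions in two simple roots at a time, so linear independence is not
  needed. Positivity gives both faithfulness and the splitting.\<close>

section \<open>Positive linear combinations\<close>

lemma PLC_add:
  assumes "x \<in> PLC A" "y \<in> PLC A"
  shows "x + y \<in> PLC A"
proof -
  obtain F c where F: "finite F" "F \<subseteq> A" "\<forall>a\<in>F. 0 \<le> c a" "\<exists>a\<in>F. 0 < c a"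
      "x = (\<Sum>a\<in>F. c a *\<^sub>R a)"
    using assms(1) unfolding PLC_def by blast
  obtain G d where G: "finite G" "G \<subseteq> A" "\<forall>a\<in>G. 0 \<le> d a" "\<exists>a\<in>G. 0 < d a"
      "y = (\<Sum>a\<in>G. d a *\<^sub>R a)"
    using assms(2) unfolding PLC_def by blast
  define e where "e a = (if a \<in> F then c a else 0) + (if a \<in> G then d a else 0)" for a
  have "x = (\<Sum>a\<in>F \<union> G. (if a \<in> F then c a else 0) *\<^sub>R a)"
    unfolding F(5) using F(1) G(1) by (intro sum.mono_neutral_cong_left) auto
  moreover have "y = (\<Sum>a\<in>F \<union> G. (if a \<in> G then d a else 0) *\<^sub>R a)"
    unfolding G(5) using F(1) G(1) by (intro sum.mono_neutral_cong_left) auto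
  ultimately have "x + y = (\<Sum>a\<in>F \<union> G. e a *\<^sub>R a)"
    by (simp add: e_def scaleR_add_left sum.distrib)
  moreover have "\<forall>a\<in>F \<union> G. 0 \<le> e a"
    using F(3) G(3) by (auto simp: e_def)
  moreover have "\<exists>a\<in>F \<union> G. 0 < e a"
    using F(4) G(3) by (force simp: e_def add_pos_nonneg)
  ultimately show ?thesis
    unfolding PLC_def using F(1,2) G(1,2) by (intro CollectI exI[of _ "F \<union> G"] exI[of _ e]) auto
qed

lemma PLC_scale:
  assumes "x \<in> PLC A" "0 < r"
  shows "r *\<^sub>R x \<in> PLC A"
proof -
  obtain F c where F: "finite F" "F \<subseteq> A" "\<forall>a\<in>F. 0 \<le> c a" "\<exists>a\<in>F. 0 < c a"
      "x = (\<Sum>a\<in>F. c a *\<^sub>R a)"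
    using assms(1) unfolding PLC_def by blast
  then have "r *\<^sub>R x = (\<Sum>a\<in>F. (r * c a) *\<^sub>R a)"
    by (simp add: scaleR_sum_right)
  then show ?thesis
    unfolding PLC_def using F assms(2)
    by (intro CollectI exI[of _ F] exI[of _ "\<lambda>a. r * c a"]) (auto intro: mult_pos_pos)
qed

lemma PLC_superset: "a \<in> A \<Longrightarrow> a \<in> PLC A"
  unfolding PLC_def by (intro CollectI exI[of _ "{a}"] exI[of _ "\<lambda>_. 1"]) auto

lemma PLC_mono: "A \<subseteq> B \<Longrightarrow> PLC A \<subseteq> PLC B"
  unfolding PLC_def by blast

lemma PLC_combination:
  assumes "x \<in> PLC A" "y \<in> PLC A" "0 \<le> a" "0 \<le> b" "0 < a \<or> 0 < b"
  shows "a *\<^sub>R x + b *\<^sub>R y \<in> PLC A"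
proof (cases "a = 0 \<or> b = 0")
  case True
  then show ?thesis using assms by (auto intro: PLC_scale)
next
  case False
  then show ?thesis using assms by (intro PLC_add PLC_scale) auto
qed

text \<open>Isolates the coefficient of a single vector. The alternative \<open>y = 0\<close> covers
  the case that no vector other than \<open>a\<close> has a positive coefficient.\<close>

lemma PLC_split_off:
  assumes "x \<in> PLC A"
  obtains r y where "0 \<le> r" "y = 0 \<or> y \<in> PLC (A - {a})" "x = r *\<^sub>R a + y"
proof -
  obtain F c where F: "finite F" "F \<subseteq> A" "\<forall>a\<in>F. 0 \<le> c a" "\<exists>a\<in>F. 0 < c a"
      "x = (\<Sum>a\<in>F. c a *\<^sub>R a)"
    using assms unfolding PLC_def by blast
  define y where "y = (\<Sum>b\<in>F - {a}. c b *\<^sub>R b)"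
  define r where "r = (if a \<in> F then c a else 0)"
  have "x = r *\<^sub>R a + y"
    using F(1) by (auto simp: F(5) y_def r_def sum.remove)
  moreover have "0 \<le> r" using F(3) by (auto simp: r_def)
  moreover have "y = 0 \<or> y \<in> PLC (A - {a})"
  proof (cases "\<exists>b\<in>F - {a}. 0 < c b")
    case True
    then have "y \<in> PLC (A - {a})"
      unfolding PLC_def y_def using F by (intro CollectI exI[of _ "F - {a}"] exI[of _ c]) auto
    then show ?thesis ..
  next
    case False
    then have "c b = 0" if "b \<in> F - {a}" for b
      using F(3) that by force
    then have "y = 0" by (simp add: y_def)
    then show ?thesis ..
  qed
  ultimately show ?thesis using that by blast
qed

text \<open>Collecting the multiples of \<open>a\<close> exhibits \<open>(x - r) *\<^sub>R a\<close>
  as an element of \<open>PLC (A - {a})\<close>. For \<open>x \<le> r\<close> this puts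
  \<open>0\<close> into \<open>PLC A\<close>; for \<open>x > r\<close> division contradicts the
  extremality of \<open>a\<close>.\<close>

lemma PLC_no_mixed_signs:
  assumes 0: "0 \<notin> PLC A" and a: "a \<in> A" "a \<notin> PLC (A - {a})" and b: "b \<in> A" "a \<noteq> b"
    and "0 < x" "0 < y"
  shows "x *\<^sub>R a - y *\<^sub>R b \<notin> PLC A"
proof
  assume "x *\<^sub>R a - y *\<^sub>R b \<in> PLC A"
  then obtain r z where r: "0 \<le> r" "z = 0 \<or> z \<in> PLC (A - {a})" "x *\<^sub>R a - y *\<^sub>R b = r *\<^sub>R a + z"
    by (rule PLC_split_off)
  define u where "u = y *\<^sub>R b + z"
  have u: "u \<in> PLC (A - {a})"
  proof -
    have "y *\<^sub>R b \<in> PLC (A - {a})"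
      using b \<open>0 < y\<close> by (intro PLC_scale PLC_superset) auto
    then show ?thesis using r(2) by (auto simp: u_def intro: PLC_add)
  qed
  have eq: "(x - r) *\<^sub>R a = u"
    using r(3) by (simp add: u_def algebra_simps)
  have uA: "u \<in> PLC A" using u PLC_mono[of "A - {a}" A] by auto
  show False
  proof (cases x r rule: linorder_cases)
    case less
    then have "(r - x) *\<^sub>R a \<in> PLC A" using a by (intro PLC_scale PLC_superset) auto
    then have "(r - x) *\<^sub>R a + u \<in> PLC A" using uA by (rule PLC_add)
    then show False using 0 by (simp flip: eq add: algebra_simps)
  next
    case equal
    then show False using eq uA 0 by simp
  next
    case greater
    then have "(1 / (x - r)) *\<^sub>R u \<in> PLC (A - {a})" using u by (intro PLC_scale) auto
    then show False using greater a by (simp flip: eq)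
  qed
qed

section \<open>Alternating words and dihedral rotations\<close>

text \<open>The recursion fixes the last letter, \<open>t\<close>, and lets the first one depend on
  the parity of the length: words act from their right end, so the reflection applied first is
  known.\<close>

fun alt_word :: "'s \<Rightarrow> 's \<Rightarrow> nat \<Rightarrow> 's list" where
  "alt_word s t 0 = []"
| "alt_word s t (Suc n) = alt_word t s n @ [t]"

lemma length_alt_word [simp]: "length (alt_word s t n) = n"
  by (induction n arbitrary: s t) auto

lemma in_set_alt_wordD: "x \<in> set (alt_word s t n) \<Longrightarrow> x = s \<or> x = t"
  by (induction n arbitrary: s t) auto

lemma alt_word_in_lists: "s \<in> S \<Longrightarrow> t \<in> S \<Longrightarrow> alt_word s t n \<in> lists S"
  by (auto dest: in_set_alt_wordD)

lemma alt_word_add: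
  "alt_word s t (n + m) = (if even m then alt_word s t n else alt_word t s n) @ alt_word s t m"
  by (induction m arbitrary: s t) auto

lemma alt_word_Cons: "alt_word s t (Suc n) = (if even n then t else s) # alt_word s t n"
  using alt_word_add[of s t 1 n]
  by (auto simp del: alt_word.simps(2) simp: One_nat_def alt_word.simps(2)[of _ _ 0])

lemma rev_alt_word: "rev (alt_word s t n) = (if even n then alt_word t s n else alt_word s t n)"
proof (induction n arbitrary: s t)
  case (Suc n)
  have "rev (alt_word s t (Suc n)) = t # rev (alt_word t s n)" by simp
  also have "\<dots> = (if even (Suc n) then alt_word t s (Suc n) else alt_word s t (Suc n))"
    by (simp add: Suc alt_word_Cons del: alt_word.simps)
  finally show ?case .
qed simp

lemma alt_word_even: "alt_word s t (2 * n) = concat (replicate n [s, t])"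
proof (induction n)
  case (Suc n)
  have "alt_word s t 2 = [s, t]" by (simp add: numeral_2_eq_2)
  have "alt_word s t (2 * Suc n) = alt_word s t (2 + 2 * n)" by simp
  also have "\<dots> = [s, t] @ alt_word s t (2 * n)"
    using alt_word_add[of s t 2 "2 * n"] by (simp add: \<open>alt_word s t 2 = [s, t]\<close>)
  finally show ?case using Suc by simp
qed simp

section \<open>Words acting as compositions, with Chebyshev coefficients\<close>

primrec act :: "('s \<Rightarrow> 'v \<Rightarrow> 'v) \<Rightarrow> 's list \<Rightarrow> 'v \<Rightarrow> 'v" where
  "act f [] = id"
| "act f (s # u) = f s \<circ> act f u"

lemma act_append: "act f (u @ v) = act f u \<circ> act f v"
  by (induction u) (auto simp: o_assoc)

lemma linear_act: "(\<And>s. s \<in> set u \<Longrightarrow> linear (f s)) \<Longrightarrow> linear (act f u)"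
  by (induction u) (auto simp: linear_compose intro: linearI)

lemma act_fixes: "(\<And>s. s \<in> set u \<Longrightarrow> f s z = z) \<Longrightarrow> act f u z = z"
  by (induction u) auto

text \<open>\<open>cheb c n\<close> is \<open>U\<^sub>n\<^sub>-\<^sub>1(c)\<close> for the Chebyshev polynomials of the second kind.\<close>

fun cheb :: "real \<Rightarrow> nat \<Rightarrow> real" where
  "cheb c 0 = 0"
| "cheb c (Suc 0) = 1"
| "cheb c (Suc (Suc n)) = 2 * c * cheb c (Suc n) - cheb c n"

text \<open>By the addition theorem, \<open>sin (n * \<theta>)\<close> satisfies the recursion that
  defines \<open>cheb (cos \<theta>)\<close>.\<close>

lemma cheb_cos: "cheb (cos \<theta>) n * sin \<theta> = sin (real n * \<theta>)"
proof (induction "cos \<theta>" n rule: cheb.induct)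
  case (3 n)
  have "sin (real (Suc (Suc n)) * \<theta>) + sin (real n * \<theta>) = 2 * cos \<theta> * sin (real (Suc n) * \<theta>)"
  proof -
    have e: "real (Suc (Suc n)) * \<theta> = real (Suc n) * \<theta> + \<theta>" "real n * \<theta> = real (Suc n) * \<theta> - \<theta>"
      by (simp_all add: algebra_simps)
    show ?thesis unfolding e sin_add sin_diff by simp
  qed
  then show ?case using 3 by (simp add: algebra_simps)
qed auto

text \<open>Strict growth is its own induction invariant: with \<open>q\<close> for
  \<open>cheb c\<close>, \<open>2 * c * q (n + 1) - q n \<ge> 2 * q (n + 1) - q n > q (n +
  1)\<close>.\<close>

lemma cheb_ge_one:
  assumes "1 \<le> c"
  shows "0 \<le> cheb c n \<and> cheb c n < cheb c (Suc n)"
proof (induction n)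
  case (Suc n)
  have "cheb c (Suc n) \<le> c * cheb c (Suc n)"
    using Suc assms by (simp add: mult_le_cancel_right1)
  moreover have "cheb c (Suc (Suc n)) = 2 * (c * cheb c (Suc n)) - cheb c n" by simp
  ultimately show ?case using Suc by linarith
qed simp

text \<open>The rightmost letter moves the pair of coefficients one step along the Chebyshev
  sequence and exchanges the roles of the two vectors. The offset \<open>j\<close> is general for
  the sake of this induction.\<close>

lemma act_alt_word:
  assumes "linear (f a)" "linear (f b)"
    and "f a ea = - ea" "f b eb = - eb"
    and "f a eb = eb + (2 * c) *\<^sub>R ea" "f b ea = ea + (2 * c) *\<^sub>R eb"
  shows "act f (alt_word a b n) (cheb c (Suc j) *\<^sub>R ea + cheb c j *\<^sub>R eb) =
    (if even n then cheb c (Suc (j + n)) *\<^sub>R ea + cheb c (j + n) *\<^sub>R eb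
     else cheb c (Suc (j + n)) *\<^sub>R eb + cheb c (j + n) *\<^sub>R ea)"
  using assms
proof (induction n arbitrary: a b ea eb j)
  case (Suc n)
  have "f b (cheb c (Suc j) *\<^sub>R ea + cheb c j *\<^sub>R eb) =
      cheb c (Suc (Suc j)) *\<^sub>R eb + cheb c (Suc j) *\<^sub>R ea"
    using Suc.prems by (simp add: linear_add linear_scale algebra_simps)
  then show ?case
    using Suc.IH[of b a eb ea "Suc j"] Suc.prems by (simp add: act_append)
qed simp

lemma act_alt_word_root:
  assumes "linear (f a)" "linear (f b)"
    and "f a ea = - ea" "f b eb = - eb"
    and "f a eb = eb + (2 * c) *\<^sub>R ea" "f b ea = ea + (2 * c) *\<^sub>R eb"
  shows "act f (alt_word a b n) ea =
    (if even n then cheb c (Suc n) *\<^sub>R ea + cheb c n *\<^sub>R eb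
     else cheb c (Suc n) *\<^sub>R eb + cheb c n *\<^sub>R ea)"
  using act_alt_word[OF assms, of n 0] by simp

lemma pi_over_bounds:
  assumes "2 \<le> m"
  shows "0 < pi / real m" "pi / real m \<le> pi / 2" "0 < sin (pi / real m)"
proof -
  show 1: "0 < pi / real m" "pi / real m \<le> pi / 2"
    using assms by (auto simp: field_simps)
  then show "0 < sin (pi / real m)"
    using pi_gt_zero by (intro sin_gt_zero) linarith+
qed

text \<open>With \<open>\<theta> = pi / m\<close> these are values of
  \<open>sin (n * \<theta>) / sin \<theta>\<close>: the first three describe a full turn, the last
  two the half turn on which the sine is nonnegative.\<close>

lemma cheb_pi_over:
  assumes "2 \<le> m"
  shows "cheb (cos (pi / real m)) (2 * m) = 0" "cheb (cos (pi / real m)) (Suc (2 * m)) = 1"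
    "cheb (cos (pi / real m)) (2 * m - 1) = -1"
    "n \<le> m \<Longrightarrow> 0 \<le> cheb (cos (pi / real m)) n"
    "0 < n \<Longrightarrow> n < m \<Longrightarrow> 0 < cheb (cos (pi / real m)) n"
proof -
  define \<theta> where "\<theta> = pi / real m"
  note s = pi_over_bounds[OF assms, folded \<theta>_def]
  have m: "real m * \<theta> = pi" using assms by (simp add: \<theta>_def)
  have e: "cheb (cos \<theta>) n = sin (real n * \<theta>) / sin \<theta>" for n
    using cheb_cos[of \<theta> n] s(3) by (simp add: field_simps)
  have m2: "real (2 * m) * \<theta> = 2 * pi" "real (Suc (2 * m)) * \<theta> = \<theta> + 2 * pi"
    "real (2 * m - 1) * \<theta> = - \<theta> + 2 * pi"
    using m assms by (simp_all add: algebra_simps of_nat_diff)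
  show "cheb (cos (pi / real m)) (2 * m) = 0" "cheb (cos (pi / real m)) (Suc (2 * m)) = 1"
    "cheb (cos (pi / real m)) (2 * m - 1) = -1"
    using s(3) by (simp_all only: \<theta>_def[symmetric] e m2 sin_periodic sin_two_pi sin_minus) simp_all
  show "0 \<le> cheb (cos (pi / real m)) n" if "n \<le> m"
  proof -
    have "real n * \<theta> \<le> real m * \<theta>" using that s(1) by (intro mult_right_mono) auto
    then have "0 \<le> sin (real n * \<theta>)" using s(1) m by (intro sin_ge_zero) auto
    then show ?thesis unfolding \<theta>_def[symmetric] e using s(3) by simp
  qed
  show "0 < cheb (cos (pi / real m)) n" if "0 < n" "n < m"
  proof -
    have "real n * \<theta> < real m * \<theta>" using that s(1) by (intro mult_strict_right_mono) auto
    then have "0 < sin (real n * \<theta>)" using s(1) m that by (intro sin_gt_zero) auto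
    then show ?thesis unfolding \<theta>_def[symmetric] e using s(3) by simp
  qed
qed

lemma act_alt_word_periodic:
  assumes f: "linear (f a)" "linear (f b)"
    "f a ea = - ea" "f b eb = - eb"
    "f a eb = eb + (2 * cos (pi / real m)) *\<^sub>R ea" "f b ea = ea + (2 * cos (pi / real m)) *\<^sub>R eb"
    and m: "2 \<le> m"
  shows "act f (alt_word a b (2 * m)) ea = ea" "act f (alt_word a b (2 * m)) eb = eb"
proof -
  show "act f (alt_word a b (2 * m)) ea = ea"
    using act_alt_word_root[OF f, of "2 * m"] cheb_pi_over(1,2)[OF m] by simp
  have n: "2 * m = Suc (2 * m - 1)" "odd (2 * m - 1)" using m by auto
  have lin: "linear (act f (alt_word b a (2 * m - 1)))"
    using alt_word_in_lists[of b "{a, b}" a "2 * m - 1"] f(1,2) by (intro linear_act) auto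
  \<comment> \<open>The last letter turns \<open>eb\<close> into \<open>- eb\<close>. The remaining
    word of odd length ends in \<open>a\<close>, so \<open>act_alt_word_root\<close> applies to it
    with the two letters exchanged.\<close>
  have "act f (alt_word a b (2 * m)) eb = act f (alt_word b a (2 * m - 1)) (f b eb)"
    by (subst n(1)) (simp add: act_append)
  also have "\<dots> = - act f (alt_word b a (2 * m - 1)) eb"
    using f(4) lin by (simp add: linear_neg)
  also have "act f (alt_word b a (2 * m - 1)) eb = - eb"
    using act_alt_word_root[of f b a eb ea, OF f(2,1,4,3,6,5), of "2 * m - 1"]
      cheb_pi_over(1,3)[OF m] n by simp
  finally show "act f (alt_word a b (2 * m)) eb = eb" by simp
qed

section \<open>Words in a Coxeter group\<close>

text \<open>\<open>k\<close> is the factor by which \<open>\<alpha> t\<close> is multiplied and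
  \<open>\<beta> t\<close> divided to make both mixed pairings equal to \<open>-c\<close>. Sharing
  one \<open>c\<close> makes the two pairings vanish together.\<close>

definition coxeter_datum ::
    "'s set \<Rightarrow> ('v \<Rightarrow> 'w \<Rightarrow> real) \<Rightarrow> ('s \<Rightarrow> 'v) \<Rightarrow> ('s \<Rightarrow> 'w) \<Rightarrow> bool" where
  "coxeter_datum S p \<alpha> \<beta> \<longleftrightarrow> (\<forall>s\<in>S. \<forall>t\<in>S. s \<noteq> t \<longrightarrow>
    (\<exists>k>0. \<exists>c\<ge>0. p (\<alpha> s) (\<beta> t) = - (c * k) \<and> p (\<alpha> t) (\<beta> s) = - (c / k) \<and>
      (1 \<le> c \<or> (\<exists>m\<ge>2. c = cos (pi / real m)))))"

locale coxeter_words =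
  fixes S :: "'s set"
    and p :: "'v::real_vector \<Rightarrow> 'w::real_vector \<Rightarrow> real"
    and \<alpha> :: "'s \<Rightarrow> 'v" and \<beta> :: "'s \<Rightarrow> 'w"
begin

abbreviation "Rel \<equiv> coxeter_relators S p \<alpha> \<beta>"

definition pos_word :: "'s list \<Rightarrow> 's gword"
  where "pos_word = map (\<lambda>s. (s, True))"

definition word_eq :: "'s list \<Rightarrow> 's list \<Rightarrow> bool" (infix "\<bumpeq>" 50)
  where "u \<bumpeq> v \<longleftrightarrow> (pos_word u, pos_word v) \<in> pres_rel S Rel"

lemma pos_word_simps [simp]:
  "pos_word [] = []" "pos_word (s # u) = (s, True) # pos_word u"
  "pos_word (u @ v) = pos_word u @ pos_word v" "length (pos_word u) = length u"
  by (simp_all add: pos_word_def)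

lemma pos_word_in_gwords [simp]: "pos_word u \<in> gwords S \<longleftrightarrow> u \<in> lists S"
  by (auto simp: pos_word_def)

lemma word_eq_refl: "u \<in> lists S \<Longrightarrow> u \<bumpeq> u"
  by (simp add: word_eq_def pres_rel.refl)

lemma word_eq_sym: "u \<bumpeq> v \<Longrightarrow> v \<bumpeq> u"
  by (simp add: word_eq_def pres_rel.sym)

lemma word_eq_trans [trans]: "u \<bumpeq> v \<Longrightarrow> v \<bumpeq> w \<Longrightarrow> u \<bumpeq> w"
  unfolding word_eq_def by (rule pres_rel.trans)

lemma word_eq_append: "u \<bumpeq> u' \<Longrightarrow> v \<bumpeq> v' \<Longrightarrow> u @ v \<bumpeq> u' @ v'"
  by (simp add: word_eq_def pres_rel.append)

lemma word_eq_in_lists: "u \<bumpeq> v \<Longrightarrow> u \<in> lists S \<and> v \<in> lists S"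
  unfolding word_eq_def by (metis pres_rel_gwords pos_word_in_gwords)

lemma word_eq_involution: "s \<in> S \<Longrightarrow> [s, s] \<bumpeq> []"
  using pres_rel.relator[of "[(s, True), (s, True)]" Rel S]
  by (auto simp: word_eq_def coxeter_relators_def)

lemma word_eq_append_involution: "u \<in> lists S \<Longrightarrow> s \<in> S \<Longrightarrow> u @ [s, s] \<bumpeq> u"
  using word_eq_append[OF word_eq_refl word_eq_involution] by fastforce

text \<open>All relators have even length. This will show that appending a generator never preserves
  the reduced length.\<close>

lemma pres_rel_parity: "(u, v) \<in> pres_rel S Rel \<Longrightarrow> even (length u) = even (length v)"
proof (induction rule: pres_rel.induct)
  case (relator u)
  have "length (concat (replicate m [x, y])) = 2 * m" for m and x y :: "'s \<times> bool"
    by (induction m) auto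
  then show ?case using relator by (auto simp: coxeter_relators_def)
qed auto

lemma word_eq_parity: "u \<bumpeq> v \<Longrightarrow> even (length u) = even (length v)"
  unfolding word_eq_def by (drule pres_rel_parity) simp

text \<open>Formal inverses can be erased: in \<open>s\<^sup>-\<^sup>1 s s\<close>, cancelling the
  first two letters leaves \<open>s\<close>, and the involution relator for the last two leaves the
  inverse of \<open>s\<close>.\<close>

lemma gword_pos_word: "x \<in> gwords S \<Longrightarrow> (x, pos_word (map fst x)) \<in> pres_rel S Rel"
proof (induction x)
  case (Cons a x)
  obtain s b where a: "a = (s, b)" by (cases a)
  then have s: "s \<in> S" using Cons by auto
  have "([(s, b)], [(s, True)]) \<in> pres_rel S Rel"
  proof (cases b)
    case True
    then show ?thesis using s by (auto intro: pres_rel.refl)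
  next
    case False
    have "[s, s] \<bumpeq> []" using s by (rule word_eq_involution)
    then have "([(s, True), (s, True)], []) \<in> pres_rel S Rel" by (simp add: word_eq_def)
    moreover have "([(s, False)], [(s, False)]) \<in> pres_rel S Rel"
      using s by (intro pres_rel.refl) auto
    ultimately have "([(s, False)] @ [(s, True), (s, True)], [(s, False)] @ []) \<in> pres_rel S Rel"
      by (intro pres_rel.append)
    then have 1: "([(s, False), (s, True), (s, True)], [(s, False)]) \<in> pres_rel S Rel" by simp
    have "([(s, False), (s, True)], []) \<in> pres_rel S Rel"
      using pres_rel.cancel[OF s, of False] by simp
    moreover have "([(s, True)], [(s, True)]) \<in> pres_rel S Rel"
      using s by (intro pres_rel.refl) auto
    ultimately have "([(s, False), (s, True)] @ [(s, True)], [] @ [(s, True)]) \<in> pres_rel S Rel"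
      by (intro pres_rel.append)
    then have 2: "([(s, False), (s, True), (s, True)], [(s, True)]) \<in> pres_rel S Rel" by simp
    show ?thesis using pres_rel.trans[OF pres_rel.sym[OF 1] 2] False by simp
  qed
  then have "([(s, b)] @ x, [(s, True)] @ pos_word (map fst x)) \<in> pres_rel S Rel"
    using Cons by (intro pres_rel.append) auto
  then show ?case by (simp add: a)
qed (auto intro: pres_rel.refl)

lemma word_eq_rev: "u \<in> lists S \<Longrightarrow> u @ rev u \<bumpeq> []"
proof (induction u rule: rev_induct)
  case (snoc s u)
  then have "(u @ [s, s]) @ rev u \<bumpeq> u @ rev u"
    by (intro word_eq_append word_eq_append_involution word_eq_refl) auto
  then show ?case using snoc word_eq_trans by simp
qed (simp add: word_eq_refl)

lemma word_eq_relator: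
  assumes "s \<in> S" "t \<in> S" "s \<noteq> t" "2 \<le> m"
    and "p (\<alpha> s) (\<beta> t) * p (\<alpha> t) (\<beta> s) = (cos (pi / real m))\<^sup>2"
  shows "alt_word s t (2 * m) \<bumpeq> []"
proof -
  have "pos_word (alt_word s t (2 * m)) = concat (replicate m [(s, True), (t, True)])"
    by (simp add: alt_word_even pos_word_def map_concat)
  moreover have "concat (replicate m [(s, True), (t, True)]) \<in> Rel"
    using assms unfolding coxeter_relators_def by blast
  moreover have "concat (replicate m [(s, True), (t, True)]) \<in> gwords S"
    using assms(1,2) by (induction m) auto
  ultimately show ?thesis
    by (simp add: word_eq_def pres_rel.relator)
qed

text \<open>Cutting the relator into halves \<open>y @ x\<close> of length \<open>m\<close> gives
  \<open>y \<bumpeq> rev x\<close>, and reversing an alternating word either keeps it or exchanges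
  its letters, according to parity.\<close>

lemma word_eq_braid:
  assumes st: "s \<in> S" "t \<in> S" and rel: "alt_word s t (2 * m) \<bumpeq> []"
  shows "alt_word s t m \<bumpeq> alt_word t s m"
proof -
  define x where "x = alt_word s t m"
  define y where "y = (if even m then x else alt_word t s m)"
  have xy: "x \<in> lists S" "y \<in> lists S"
    using st by (auto simp: x_def y_def dest: in_set_alt_wordD)
  have yx: "alt_word s t (2 * m) = y @ x"
    using alt_word_add[of s t m m] by (simp add: x_def y_def mult_2)
  have "y \<bumpeq> y @ (x @ rev x)"
    using word_eq_append[OF word_eq_refl[OF xy(2)] word_eq_sym[OF word_eq_rev[OF xy(1)]]] by simp
  also have "y @ (x @ rev x) \<bumpeq> [] @ rev x"
    using rel word_eq_refl[of "rev x"] xy(1) in_lists_conv_set[of "rev x"] unfolding yx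
    by (subst append_assoc[symmetric], intro word_eq_append) auto
  finally have "y \<bumpeq> rev x" by simp
  then show ?thesis
    using word_eq_sym by (auto simp: x_def y_def rev_alt_word split: if_splits)
qed

section \<open>Reduced words\<close>

definition reduced :: "'s list \<Rightarrow> bool"
  where "reduced u \<longleftrightarrow> u \<in> lists S \<and> (\<forall>v. u \<bumpeq> v \<longrightarrow> length u \<le> length v)"

lemma reduced_in_lists: "reduced u \<Longrightarrow> u \<in> lists S"
  by (simp add: reduced_def)

lemma reduced_le: "reduced u \<Longrightarrow> u \<bumpeq> v \<Longrightarrow> length u \<le> length v"
  by (simp add: reduced_def)

lemma ex_reduced:
  assumes "u \<in> lists S"
  obtains v where "reduced v" "u \<bumpeq> v"
proof -
  have "\<exists>v. u \<bumpeq> v" using assms word_eq_refl by blast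
  then obtain v where "u \<bumpeq> v" "\<forall>w. u \<bumpeq> w \<longrightarrow> length v \<le> length w"
    using ex_has_least_nat[of "\<lambda>v. u \<bumpeq> v" _ length] by blast
  then show ?thesis
    using that[of v] word_eq_in_lists word_eq_trans unfolding reduced_def by blast
qed

lemma reduced_appendD:
  assumes "reduced (u @ v)"
  shows "reduced u" "reduced v"
proof -
  have uv: "u \<in> lists S" "v \<in> lists S" using reduced_in_lists[OF assms] by auto
  show "reduced u"
    unfolding reduced_def
  proof (intro conjI allI impI)
    fix w assume "u \<bumpeq> w"
    then have "u @ v \<bumpeq> w @ v" using uv by (intro word_eq_append word_eq_refl)
    then show "length u \<le> length w" using reduced_le[OF assms] by fastforce
  qed (use uv in simp)
  show "reduced v"
    unfolding reduced_def
  proof (intro conjI allI impI)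
    fix w assume "v \<bumpeq> w"
    then have "u @ v \<bumpeq> u @ w" using uv by (intro word_eq_append word_eq_refl)
    then show "length v \<le> length w" using reduced_le[OF assms] by fastforce
  qed (use uv in simp)
qed

lemma reduced_cong:
  assumes "reduced u" "u \<bumpeq> v" "length v = length u"
  shows "reduced v"
  using assms word_eq_in_lists word_eq_trans unfolding reduced_def by metis

lemma not_reduced_double: "\<not> reduced (u @ [s, s])"
proof
  assume r: "reduced (u @ [s, s])"
  then have "u \<in> lists S" "s \<in> S" using reduced_in_lists by force+
  then show False using reduced_le[OF r word_eq_append_involution] by simp
qed

text \<open>A word shorter than \<open>v @ [s]\<close> in its class cannot have the length of
  \<open>v\<close>, by parity, and cannot be shorter by more than two letters, as \<open>v\<close>
  is reduced. Appending \<open>s\<close> to it gives back \<open>v\<close>.\<close>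

lemma not_reduced_snocE:
  assumes v: "reduced v" "s \<in> S" and n: "\<not> reduced (v @ [s])"
  obtains v' where "v \<bumpeq> v' @ [s]" "Suc (length v') = length v" "reduced (v' @ [s])"
proof -
  have vS: "v \<in> lists S" using v reduced_in_lists by blast
  obtain v' where v': "v @ [s] \<bumpeq> v'" "length v' < Suc (length v)"
    using n vS v(2) by (auto simp: reduced_def not_le)
  have "length v' \<noteq> length v" using word_eq_parity[OF v'(1)] by auto
  have "v \<bumpeq> v @ [s, s]" using word_eq_append_involution[OF vS v(2)] by (rule word_eq_sym)
  also have "v @ [s, s] = (v @ [s]) @ [s]" by simp
  also have "\<dots> \<bumpeq> v' @ [s]" using v' v(2) by (intro word_eq_append word_eq_refl) auto
  finally have e: "v \<bumpeq> v' @ [s]" .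
  moreover from this have l: "Suc (length v') = length v"
    using reduced_le[OF v(1) e] v'(2) \<open>length v' \<noteq> length v\<close> by simp
  moreover have "reduced (v' @ [s])" using reduced_cong[OF v(1) e] l by simp
  ultimately show ?thesis using that by blast
qed

text \<open>Equal adjacent letters would cancel, so the last letter of \<open>u\<close> is
  \<open>t\<close>; the induction continues with \<open>s\<close> and \<open>t\<close>
  exchanged.\<close>

lemma reduced_snoc_alternating:
  assumes "u \<in> lists {s, t}" "reduced (u @ [s])"
  shows "u = alt_word s t (length u)"
  using assms
proof (induction u arbitrary: s t rule: rev_induct)
  case (snoc x u)
  have "x \<noteq> s" using snoc.prems(2) not_reduced_double[of u s] by auto
  then have x: "x = t" using snoc.prems(1) by auto
  moreover have "reduced (u @ [t])"
    using snoc.prems(2) reduced_appendD(1) x by blast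
  ultimately have "u = alt_word t s (length u)"
    using snoc.prems(1) by (intro snoc.IH) auto
  then show ?case by (simp add: x)
qed simp

end


section \<open>From the root system to the Coxeter datum\<close>

text \<open>The hypotheses are stated for one side of the pairing; the second space is treated by
  interpreting the locale with the pairing flipped and \<open>\<alpha>\<close>,
  \<open>\<beta>\<close> exchanged.\<close>

locale root_pairing = coxeter_words S p \<alpha> \<beta>
  for S :: "'s set" and p :: "'v::real_vector \<Rightarrow> 'w::real_vector \<Rightarrow> real"
    and \<alpha> :: "'s \<Rightarrow> 'v" and \<beta> :: "'s \<Rightarrow> 'w" +
  assumes bilinear: "bilinear p"
    and inj: "inj_on \<alpha> S"
    and normalized: "s \<in> S \<Longrightarrow> p (\<alpha> s) (\<beta> s) = 1"
    and zero_notin_PLC: "0 \<notin> PLC (\<alpha> ` S)"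
    and extremal: "s \<in> S \<Longrightarrow> \<alpha> s \<notin> PLC (\<alpha> ` S - {\<alpha> s})"
begin

abbreviation "\<rho> \<equiv> rho1 p \<alpha> \<beta>"
abbreviation "W1 \<equiv> refl_group S \<rho>"

lemma rho_in_GL: "s \<in> S \<Longrightarrow> \<rho> s \<in> carrier GL"
  by (rule rho1_in_GL[OF bilinear]) (rule normalized)

lemma linear_rho: "s \<in> S \<Longrightarrow> linear (\<rho> s)"
  using rho_in_GL[of s] by (simp add: GL_def)

lemma linear_act_rho: "u \<in> lists S \<Longrightarrow> linear (act \<rho> u)"
  by (rule linear_act) (auto intro: linear_rho)

lemma rho_self: "s \<in> S \<Longrightarrow> \<rho> s (\<alpha> s) = - \<alpha> s"
  by (simp add: rho1_def normalized scaleR_2)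

lemma rho_involution: "s \<in> S \<Longrightarrow> \<rho> s \<circ> \<rho> s = id"
  by (rule ext)
    (simp add: rho1_def bilinear_lsub[OF bilinear] bilinear_lmul[OF bilinear] normalized
      algebra_simps)

lemma group_W1: "group W1"
  unfolding refl_group_def by (rule group.group_subgroup_generated[OF group_GL])

lemma one_W1: "\<one>\<^bsub>W1\<^esub> = id"
  by (simp add: refl_group_def GL_def)

lemma mult_W1: "f \<otimes>\<^bsub>W1\<^esub> g = f \<circ> g"
  by (simp add: refl_group_def GL_def)

lemma carrier_W1: "carrier W1 = generate GL (\<rho> ` S)"
proof -
  have "carrier GL \<inter> \<rho> ` S = \<rho> ` S" using rho_in_GL by blast
  then show ?thesis by (simp add: refl_group_def carrier_subgroup_generated)
qed

lemma rho_in_W1: "s \<in> S \<Longrightarrow> \<rho> s \<in> carrier W1"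
  unfolding carrier_W1 by (auto intro: generate.incl)

lemma act_in_W1: "u \<in> lists S \<Longrightarrow> act \<rho> u \<in> carrier W1"
proof (induction u)
  case Nil
  show ?case using monoid.one_closed[OF group.is_monoid[OF group_W1]] by (simp add: one_W1 del: id_apply flip: id_def)
next
  case (Cons s u)
  then show ?case
    using rho_in_W1 monoid.m_closed[OF group.is_monoid[OF group_W1]]
    by (fastforce simp flip: mult_W1)
qed

text \<open>The reflections are their own inverses, so words without inverses exhaust the generated
  group.\<close>

lemma W1_eq_act:
  assumes "w \<in> carrier W1"
  obtains u where "u \<in> lists S" "w = act \<rho> u"
proof -
  have "w \<in> generate GL (\<rho> ` S)" using assms by (simp add: carrier_W1)
  then have "\<exists>u\<in>lists S. w = act \<rho> u"
  proof (induction rule: generate.induct)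
    case one
    then show ?case by (auto simp: GL_def intro!: bexI[of _ "[]"])
  next
    case (incl h)
    then obtain s where "s \<in> S" "h = \<rho> s" by blast
    then show ?case by (intro bexI[of _ "[s]"]) auto
  next
    case (inv h)
    then obtain s where s: "s \<in> S" "h = \<rho> s" by blast
    have "\<rho> s \<otimes>\<^bsub>GL\<^esub> \<rho> s = \<one>\<^bsub>GL\<^esub>"
      using rho_involution[OF s(1)] by (simp add: GL_def)
    then have "inv\<^bsub>GL\<^esub> h = \<rho> s"
      using group.inv_equality[OF group_GL] rho_in_GL s by blast
    then show ?case using s by (intro bexI[of _ "[s]"]) auto
  next
    case (eng h1 h2)
    then obtain u v where "u \<in> lists S" "v \<in> lists S" "h1 = act \<rho> u" "h2 = act \<rho> v" by blast
    then show ?case by (intro bexI[of _ "u @ v"]) (auto simp: act_append GL_def)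
  qed
  then show ?thesis using that by blast
qed

lemma act_root: "u \<in> lists S \<Longrightarrow> s \<in> S \<Longrightarrow> act \<rho> u (\<alpha> s) \<in> roots S \<rho> \<alpha>"
  unfolding roots_def using act_in_W1 by blast

lemma rootsE:
  assumes "x \<in> roots S \<rho> \<alpha>"
  obtains u s where "u \<in> lists S" "s \<in> S" "x = act \<rho> u (\<alpha> s)"
proof -
  obtain w s where "w \<in> carrier W1" "s \<in> S" "x = w (\<alpha> s)"
    using assms unfolding roots_def by blast
  then show ?thesis using W1_eq_act that by metis
qed

section \<open>Restrictions on the pairing imposed by a splitting\<close>

lemma no_mixed_signs:
  assumes "s \<in> S" "t \<in> S" "s \<noteq> t" "0 < x" "0 < y"
  shows "x *\<^sub>R \<alpha> s - y *\<^sub>R \<alpha> t \<notin> PLC (\<alpha> ` S)"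
  using assms inj
  by (intro PLC_no_mixed_signs zero_notin_PLC extremal) (auto dest: inj_onD)

text \<open>Negation only exchanges \<open>s\<close> and \<open>t\<close>, so
  \<open>no_mixed_signs\<close> rules out positive and negative roots alike.\<close>

lemma no_mixed_root:
  assumes split: "roots_split S \<rho> \<alpha>"
    and st: "s \<in> S" "t \<in> S" "s \<noteq> t" and xy: "0 < x" "0 < y"
  shows "x *\<^sub>R \<alpha> s - y *\<^sub>R \<alpha> t \<notin> roots S \<rho> \<alpha>"
proof
  assume "x *\<^sub>R \<alpha> s - y *\<^sub>R \<alpha> t \<in> roots S \<rho> \<alpha>"
  then have "x *\<^sub>R \<alpha> s - y *\<^sub>R \<alpha> t \<in> pos_roots S \<rho> \<alpha> \<union> neg_roots S \<rho> \<alpha>"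
    using split unfolding roots_split_def by blast
  then show False
  proof
    assume "x *\<^sub>R \<alpha> s - y *\<^sub>R \<alpha> t \<in> neg_roots S \<rho> \<alpha>"
    then obtain z where "z \<in> PLC (\<alpha> ` S)" "x *\<^sub>R \<alpha> s - y *\<^sub>R \<alpha> t = - z"
      unfolding neg_roots_def pos_roots_def by blast
    moreover from this have "z = y *\<^sub>R \<alpha> t - x *\<^sub>R \<alpha> s" by (metis minus_diff_eq minus_minus)
    ultimately show False using no_mixed_signs st xy by metis
  qed (use no_mixed_signs st xy in \<open>auto simp: pos_roots_def\<close>)
qed

text \<open>Rescaling \<open>\<alpha> t\<close> by \<open>k\<close> brings the two reflections into
  the symmetric form that \<open>act_alt_word_root\<close> requires.\<close>

lemma dihedral_action:
  assumes st: "s \<in> S" "t \<in> S" and k: "k \<noteq> 0"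
    and "p (\<alpha> s) (\<beta> t) = - (c * k)" "p (\<alpha> t) (\<beta> s) = - (c / k)"
  shows "linear (\<rho> s)" "linear (\<rho> t)"
    "\<rho> s (\<alpha> s) = - \<alpha> s" "\<rho> t (k *\<^sub>R \<alpha> t) = - (k *\<^sub>R \<alpha> t)"
    "\<rho> s (k *\<^sub>R \<alpha> t) = k *\<^sub>R \<alpha> t + (2 * c) *\<^sub>R \<alpha> s"
    "\<rho> t (\<alpha> s) = \<alpha> s + (2 * c) *\<^sub>R (k *\<^sub>R \<alpha> t)"
  using assms linear_rho rho_self
  by (auto simp: linear_scale) (auto simp: rho1_def algebra_simps)

text \<open>Otherwise the root obtained by reflecting \<open>\<alpha> t\<close> in \<open>s\<close>
  has mixed signs.\<close>

lemma pairing_nonpos: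
  assumes "roots_split S \<rho> \<alpha>" and st: "s \<in> S" "t \<in> S" "s \<noteq> t"
  shows "p (\<alpha> t) (\<beta> s) \<le> 0"
proof (rule ccontr)
  assume n: "\<not> p (\<alpha> t) (\<beta> s) \<le> 0"
  have "act \<rho> [s] (\<alpha> t) \<in> roots S \<rho> \<alpha>" using st by (intro act_root) auto
  then have "1 *\<^sub>R \<alpha> t - (2 * p (\<alpha> t) (\<beta> s)) *\<^sub>R \<alpha> s \<in> roots S \<rho> \<alpha>"
    by (simp add: rho1_def)
  then show False using no_mixed_root[OF assms(1), of t s 1] st n by auto
qed

text \<open>Otherwise applying \<open>\<rho> t\<close> and then \<open>\<rho> s\<close> to
  \<open>\<alpha> s\<close> gives a root with mixed signs.\<close>

lemma pairing_zero:
  assumes split: "roots_split S \<rho> \<alpha>" and st: "s \<in> S" "t \<in> S" "s \<noteq> t"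
    and z: "p (\<alpha> t) (\<beta> s) = 0"
  shows "p (\<alpha> s) (\<beta> t) = 0"
proof (rule ccontr)
  assume n: "p (\<alpha> s) (\<beta> t) \<noteq> 0"
  then have n: "p (\<alpha> s) (\<beta> t) < 0" using pairing_nonpos[OF split, of t s] st by auto
  have "act \<rho> [s, t] (\<alpha> s) \<in> roots S \<rho> \<alpha>" using st by (intro act_root) auto
  also have "act \<rho> [s, t] (\<alpha> s) = (- 2 * p (\<alpha> s) (\<beta> t)) *\<^sub>R \<alpha> t - 1 *\<^sub>R \<alpha> s"
    using z normalized[OF st(1)]
    by (simp add: rho1_def bilinear_lsub[OF bilinear] bilinear_lmul[OF bilinear] algebra_simps
        scaleR_2)
  finally show False
    using no_mixed_root[OF split, of t s "- 2 * p (\<alpha> s) (\<beta> t)" 1] st n by auto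
qed

lemma split_imp_datum:
  assumes split: "roots_split S \<rho> \<alpha>"
  shows "coxeter_datum S p \<alpha> \<beta>"
  unfolding coxeter_datum_def
proof (intro ballI impI)
  fix s t assume st: "s \<in> S" "t \<in> S" "s \<noteq> t"
  define x y where "x = - p (\<alpha> s) (\<beta> t)" and "y = - p (\<alpha> t) (\<beta> s)"
  have xy: "0 \<le> x" "0 \<le> y" "x = 0 \<longleftrightarrow> y = 0"
    using pairing_nonpos[OF split] pairing_zero[OF split] st by (auto simp: x_def y_def)
  show "\<exists>k>0. \<exists>c\<ge>0. p (\<alpha> s) (\<beta> t) = - (c * k) \<and> p (\<alpha> t) (\<beta> s) = - (c / k) \<and>
      (1 \<le> c \<or> (\<exists>m\<ge>2. c = cos (pi / real m)))"
  proof (cases "x = 0")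
    case True
    \<comment> \<open>Here \<open>c = 0 = cos (pi / 2)\<close>, so \<open>m = 2\<close>.\<close>
    then show ?thesis using xy
      by (intro exI[of _ 1] conjI exI[of _ 0] disjI2 exI[of _ 2]) (auto simp: x_def y_def)
  next
    case False
    then have pos: "0 < x" "0 < y" using xy by auto
    \<comment> \<open>The solution of \<open>c * k = x\<close> and \<open>c / k = y\<close>.\<close>
    define k c where "k = sqrt (x / y)" and "c = sqrt (x * y)"
    have k: "0 < k" and c: "0 < c" using pos by (auto simp: k_def c_def)
    have "c * k = sqrt (x * x)" "c / k = sqrt (y * y)"
      using pos by (simp_all add: c_def k_def flip: real_sqrt_mult real_sqrt_divide)
    then have ck: "p (\<alpha> s) (\<beta> t) = - (c * k)" "p (\<alpha> t) (\<beta> s) = - (c / k)"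
      using pos by (simp_all add: x_def y_def)
    have "\<exists>m\<ge>2. c = cos (pi / real m)" if "c < 1"
    proof -
      define \<theta> where "\<theta> = arccos c"
      have cos: "cos \<theta> = c" using that c by (simp add: \<theta>_def)
      have th: "0 < \<theta>" "\<theta> < pi"
        using that c arccos_lt_bounded[of c] by (auto simp: \<theta>_def)
      \<comment> \<open>The least \<open>n\<close> with \<open>n * \<theta> \<ge> pi\<close>. Its
        predecessor \<open>j\<close> is still inside the first half turn, whereas
        \<open>n * \<theta>\<close> is either \<open>pi\<close> or strictly inside the second, where
        the sine is negative.\<close>
      define n where "n = nat (\<lceil>pi / \<theta>\<rceil>)"
      have n: "pi / \<theta> \<le> real n" "real n < pi / \<theta> + 1"
        using ceiling_correct[of "pi / \<theta>"] divide_pos_pos[OF pi_gt_zero th(1)] unfolding n_def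
        by linarith+
      have n2: "1 < real n" using n(1) th by (smt (verit) less_divide_eq_1_pos)
      then obtain j where j: "n = Suc j" "0 < j" by (cases n) auto
      have b: "pi \<le> real n * \<theta>" "real n * \<theta> < pi + \<theta>" using n th by (auto simp: field_simps)
      show ?thesis
      proof (cases "real n * \<theta> = pi")
        case True
        then have "\<theta> = pi / real n" using n2 by (simp add: field_simps)
        then show ?thesis using cos n2 by (intro exI[of _ n]) auto
      next
        case False
        have sin: "0 < sin \<theta>" using th by (rule sin_gt_zero)
        have "0 < sin (real j * \<theta>)"
          using b j th by (intro sin_gt_zero) (auto simp: algebra_simps)
        then have qj: "0 < cheb c j" 
          using cheb_cos[of \<theta> j] sin cos by (metis zero_less_mult_pos2)
        have "sin (real n * \<theta>) < 0"
          using b False th by (intro sin_lt_zero) auto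
        then have qn: "cheb c n < 0" 
          using cheb_cos[of \<theta> n] sin cos by (metis mult_nonneg_nonneg less_imp_le not_less)
        have root: "act \<rho> (alt_word s t j) (\<alpha> s) \<in> roots S \<rho> \<alpha>"
          using st by (intro act_root alt_word_in_lists)
        \<comment> \<open>Up to the factor \<open>k\<close>, the coefficients are
          \<open>cheb c n < 0\<close> and \<open>cheb c j > 0\<close>; the parity of
          \<open>j\<close> decides which simple root carries which.\<close>
        note act_w = act_alt_word_root[OF dihedral_action[OF st(1,2) _ ck], of j, folded j(1)]
        have False
        proof (cases "even j")
          case True
          then have "act \<rho> (alt_word s t j) (\<alpha> s) =
              (cheb c j * k) *\<^sub>R \<alpha> t - (- cheb c n) *\<^sub>R \<alpha> s"
            using act_w k by simp
          moreover have "0 < cheb c j * k" "0 < - cheb c n" using qj qn k by simp_all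
          ultimately show False using root no_mixed_root[OF split st(2,1)] st(3) by metis
        next
          case False
          then have "act \<rho> (alt_word s t j) (\<alpha> s) =
              cheb c j *\<^sub>R \<alpha> s - (- (cheb c n * k)) *\<^sub>R \<alpha> t"
            using act_w k by simp
          moreover have "0 < - (cheb c n * k)" using qn k by (simp add: mult_neg_pos)
          ultimately show False using root no_mixed_root[OF split st] qj by metis
        qed
        then show ?thesis ..
      qed
    qed
    then show ?thesis using k c ck by force
  qed
qed

end

section \<open>From the Coxeter datum to the root system\<close>

text \<open>Assumes the datum instead of a splitting: the datum survives the exchange of the two
  spaces, so the results below become available for both.\<close>

locale coxeter_pairing = root_pairing +
  assumes datum: "coxeter_datum S p \<alpha> \<beta>"
begin

lemma datumE:
  assumes "s \<in> S" "t \<in> S" "s \<noteq> t"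
  obtains k c where "0 < k" "0 \<le> c" "p (\<alpha> s) (\<beta> t) = - (c * k)" "p (\<alpha> t) (\<beta> s) = - (c / k)"
    "1 \<le> c \<or> (\<exists>m\<ge>2. c = cos (pi / real m))"
  using datum assms unfolding coxeter_datum_def by blast

text \<open>The Gram matrix of \<open>\<alpha> s, \<alpha> t\<close> against \<open>\<beta> s, \<beta> t\<close> has determinant \<open>sin\<^sup>2(\<pi>/m) \<noteq> 0\<close>, so
  the whole space is the span of \<open>\<alpha> s, \<alpha> t\<close> plus the common kernel of \<open>\<beta> s, \<beta> t\<close>, on which
  both reflections are trivial.\<close>

lemma act_relator:
  assumes st: "s \<in> S" "t \<in> S" "s \<noteq> t" and m: "2 \<le> m"
    and rel: "p (\<alpha> s) (\<beta> t) * p (\<alpha> t) (\<beta> s) = (cos (pi / real m))\<^sup>2"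
  shows "act \<rho> (alt_word s t (2 * m)) = id"
proof
  fix z
  obtain k c where kc: "0 < k" "0 \<le> c" "p (\<alpha> s) (\<beta> t) = - (c * k)" "p (\<alpha> t) (\<beta> s) = - (c / k)"
    using datumE[OF st] by metis
  \<comment> \<open>The relator determines \<open>c\<close> only up to sign; both candidates are
    nonnegative because \<open>m \<ge> 2\<close>.\<close>
  have "c\<^sup>2 = (cos (pi / real m))\<^sup>2" using rel kc by (simp add: power2_eq_square)
  moreover have "0 \<le> cos (pi / real m)"
    using pi_over_bounds[OF m] by (intro cos_ge_zero) auto
  ultimately have c: "c = cos (pi / real m)" using kc(2) by (simp add: power2_eq_iff_nonneg)
  define w where "w = act \<rho> (alt_word s t (2 * m))"
  note d = dihedral_action[OF st(1,2) _ kc(3,4)]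
  have ws: "w (\<alpha> s) = \<alpha> s" and wt: "w (k *\<^sub>R \<alpha> t) = k *\<^sub>R \<alpha> t"
    using act_alt_word_periodic[OF d[unfolded c] m] kc(1) unfolding w_def c by auto
  have lin: "linear w" unfolding w_def using st by (intro linear_act_rho alt_word_in_lists)
  have "k *\<^sub>R w (\<alpha> t) = k *\<^sub>R \<alpha> t" using wt lin by (simp add: linear_scale)
  then have wt: "w (\<alpha> t) = \<alpha> t" using kc(1) by simp
  define P Q D where "P = p z (\<beta> s)" and "Q = p z (\<beta> t)" and "D = (sin (pi / real m))\<^sup>2"
  have D: "D \<noteq> 0" "D = 1 - c * c"
    using pi_over_bounds(3)[OF m] by (simp_all only: D_def c sin_squared_eq[symmetric]
        flip: power2_eq_square) simp
  \<comment> \<open>Cramer's rule for the coefficients that make \<open>z0\<close> below pair to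
    zero with \<open>\<beta> s\<close> and \<open>\<beta> t\<close>; the determinant is
    \<open>D\<close>.\<close>
  define u v where "u = (P + (c / k) * Q) / D" and "v = (Q + (c * k) * P) / D"
  have uv: "u - (c / k) * v = P" "v - (c * k) * u = Q"
  proof -
    have "D * (u - (c / k) * v) = D * P" "D * (v - (c * k) * u) = D * Q"
      using D(1) kc(1) unfolding u_def v_def by (simp_all add: field_simps, simp_all add: D(2) algebra_simps)
    then show "u - (c / k) * v = P" "v - (c * k) * u = Q" using D(1) by simp_all
  qed
  define z0 where "z0 = z - u *\<^sub>R \<alpha> s - v *\<^sub>R \<alpha> t"
  have "p z0 (\<beta> s) = 0" "p z0 (\<beta> t) = 0"
    using uv st(1,2) kc(3,4) unfolding z0_def bilinear_lsub[OF bilinear] bilinear_lmul[OF bilinear]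
    by (simp_all add: P_def Q_def normalized mult.commute)
  then have "w z0 = z0"
    unfolding w_def using alt_word_in_lists[of s "{s, t}" t "2 * m"]
    by (intro act_fixes) (auto simp: rho1_def)
  moreover have "z = z0 + u *\<^sub>R \<alpha> s + v *\<^sub>R \<alpha> t" by (simp add: z0_def)
  ultimately show "act \<rho> (alt_word s t (2 * m)) z = id z"
    using ws wt lin by (simp add: linear_add linear_scale flip: w_def)
qed

section \<open>The homomorphism onto the reflection group and dihedral positivity\<close>

lemma gword_eval_pos_word: "gword_eval W1 \<rho> (pos_word u) = act \<rho> u"
  by (induction u) (simp_all add: one_W1 mult_W1)

text \<open>The universal property applies since all relators act trivially. The description of
  \<open>h\<close> on arbitrary words shows that \<open>act\<close> depends only on the class, and
  later identifies the kernel.\<close>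

lemma ex_hom:
  "\<exists>h\<in>hom (coxeter_group S p \<alpha> \<beta>) W1.
    (\<forall>s\<in>S. h (coxeter_gen S p \<alpha> \<beta> s) = \<rho> s) \<and>
    (\<forall>u\<in>lists S. h (pres_class S Rel (pos_word u)) = act \<rho> u)"
proof -
  have "gword_eval W1 \<rho> u = \<one>\<^bsub>W1\<^esub>" if "u \<in> Rel" for u
    using that unfolding coxeter_relators_def
  proof
    assume "u \<in> {[(s, True), (s, True)] | s. s \<in> S}"
    then obtain s where "s \<in> S" "u = pos_word [s, s]" by auto
    then show ?thesis unfolding \<open>u = _\<close> gword_eval_pos_word using rho_involution by (simp add: one_W1)
  next
    assume "u \<in> {concat (replicate m [(s, True), (t, True)]) | s t m.
      s \<in> S \<and> t \<in> S \<and> s \<noteq> t \<and> 2 \<le> m \<and> p (\<alpha> s) (\<beta> t) * p (\<alpha> t) (\<beta> s) = (cos (pi / real m))\<^sup>2}"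
    then obtain s t m where stm: "s \<in> S" "t \<in> S" "s \<noteq> t" "2 \<le> m"
      "p (\<alpha> s) (\<beta> t) * p (\<alpha> t) (\<beta> s) = (cos (pi / real m))\<^sup>2"
      and u: "u = concat (replicate m [(s, True), (t, True)])" by blast
    have "u = pos_word (alt_word s t (2 * m))"
      by (simp add: u alt_word_even pos_word_def map_concat)
    then show ?thesis using act_relator[OF stm] by (simp only: gword_eval_pos_word one_W1)
  qed
  moreover have "\<rho> \<in> S \<rightarrow> carrier W1" using rho_in_W1 by blast
  ultimately obtain h where h: "h \<in> hom (presented_group S Rel) W1"
      "\<forall>s\<in>S. h (pres_gen S Rel s) = \<rho> s"
    using presented_group_universal[OF group_W1] by blast
  have "h (pres_class S Rel (pos_word u)) = act \<rho> u" if "u \<in> lists S" for u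
    using that
  proof (induction u)
    case Nil
    interpret group_hom "presented_group S Rel" W1 h
      using h(1) group_presented_group group_W1 by (simp add: group_hom_def group_hom_axioms_def)
    show ?case using hom_one by (simp add: one_presented_group one_W1)
  next
    case (Cons s u)
    have c: "pres_class S Rel (pos_word v) \<in> carrier (presented_group S Rel)" if "v \<in> lists S" for v
      using that by (simp add: carrier_presented_group)
    have "pres_class S Rel (pos_word (s # u)) =
        pres_gen S Rel s \<otimes>\<^bsub>presented_group S Rel\<^esub> pres_class S Rel (pos_word u)"
      unfolding pres_gen_def using Cons by (subst mult_presented_group) auto
    then have "h (pres_class S Rel (pos_word (s # u))) =
        h (pres_gen S Rel s) \<otimes>\<^bsub>W1\<^esub> h (pres_class S Rel (pos_word u))"
      using hom_mult[OF h(1)] c[of u] c[of "[s]"] Cons by (simp add: pres_gen_def)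
    then show ?case using Cons h(2) by (simp add: mult_W1)
  qed
  then show ?thesis
    using h unfolding coxeter_group_def coxeter_gen_def by blast
qed

lemma act_cong:
  assumes "u \<bumpeq> v"
  shows "act \<rho> u = act \<rho> v"
proof -
  have "u \<in> lists S" "v \<in> lists S" using word_eq_in_lists[OF assms] by auto
  moreover from this have "pres_class S Rel (pos_word u) = pres_class S Rel (pos_word v)"
    using assms by (simp only: pres_class_eq_iff pos_word_in_gwords word_eq_def)
  ultimately show ?thesis using ex_hom by metis
qed

text \<open>A reduced alternating word that stays reduced after appending \<open>s\<close> is shorter than \<open>m\<close>, so
  that the Chebyshev coefficients have not yet changed sign.\<close>

lemma act_dihedral_root:
  assumes st: "s \<in> S" "t \<in> S" "s \<noteq> t" and u: "u \<in> lists {s, t}" "reduced (u @ [s])"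
  obtains a b where "0 \<le> a" "0 \<le> b" "0 < a \<or> 0 < b" "act \<rho> u (\<alpha> s) = a *\<^sub>R \<alpha> s + b *\<^sub>R \<alpha> t"
proof -
  define n where "n = length u"
  have ua: "u = alt_word s t n" using reduced_snoc_alternating[OF u] by (simp add: n_def)
  obtain k c where kc: "0 < k" "0 \<le> c" "p (\<alpha> s) (\<beta> t) = - (c * k)" "p (\<alpha> t) (\<beta> s) = - (c / k)"
      "1 \<le> c \<or> (\<exists>m\<ge>2. c = cos (pi / real m))"
    using datumE[OF st] by metis
  have q: "0 \<le> cheb c n" "0 \<le> cheb c (Suc n)" "0 < cheb c n \<or> 0 < cheb c (Suc n)"
  proof -
    have "0 \<le> cheb c n \<and> 0 \<le> cheb c (Suc n) \<and> (0 < cheb c n \<or> 0 < cheb c (Suc n))"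
      using kc(5)
    proof
      assume "1 \<le> c"
      then show ?thesis using cheb_ge_one[of c n] by auto
    next
      assume "\<exists>m\<ge>2. c = cos (pi / real m)"
      then obtain m where m: "2 \<le> m" "c = cos (pi / real m)" by blast
      \<comment> \<open>Otherwise a braid relation makes the last \<open>m\<close> letters of
        \<open>u\<close> end in \<open>s\<close>, which cancels against the appended
        \<open>s\<close>; the word drops from length \<open>n + 1\<close> to
        \<open>n - 1\<close>.\<close>
      have "n < m"
      proof (rule ccontr)
        assume "\<not> n < m"
        define x where "x = (if even m then alt_word s t (n - m) else alt_word t s (n - m))"
        have x: "x \<in> lists S" "length x = n - m"
          using st by (auto simp: x_def dest: in_set_alt_wordD)
        have ux: "u = x @ alt_word s t m"
          using alt_word_add[of s t "n - m" m] \<open>\<not> n < m\<close> by (simp add: ua x_def)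
        have e: "alt_word t s m = alt_word s t (m - 1) @ [s]" using m(1) by (cases m) auto
        have "p (\<alpha> s) (\<beta> t) * p (\<alpha> t) (\<beta> s) = (cos (pi / real m))\<^sup>2"
          using kc m by (simp add: power2_eq_square)
        then have "alt_word s t m \<bumpeq> alt_word t s m"
          using st m(1) by (intro word_eq_braid word_eq_relator)
        then have "x @ alt_word s t m @ [s] \<bumpeq> x @ alt_word t s m @ [s]"
          using x st by (intro word_eq_append word_eq_refl) auto
        also have "x @ alt_word t s m @ [s] = (x @ alt_word s t (m - 1)) @ [s, s]"
          by (simp add: e)
        also have "\<dots> \<bumpeq> x @ alt_word s t (m - 1)"
          using x st by (intro word_eq_append_involution) (auto dest: in_set_alt_wordD)
        finally have "u @ [s] \<bumpeq> x @ alt_word s t (m - 1)" by (simp add: ux)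
        from reduced_le[OF u(2) this] show False using x m(1) \<open>\<not> n < m\<close> by (simp add: n_def)
      qed
      \<comment> \<open>The coefficient at \<open>n + 1\<close> may vanish, namely for
        \<open>n + 1 = m\<close>. A positive one is the one at \<open>n\<close> if
        \<open>n > 0\<close>, and \<open>cheb c 1 = 1\<close> if \<open>n = 0\<close>.\<close>
      then show ?thesis
        using cheb_pi_over(4)[OF m(1), of n] cheb_pi_over(4)[OF m(1), of "Suc n"]
          cheb_pi_over(5)[OF m(1), of n] m by (cases "n = 0") auto
    qed
    then show "0 \<le> cheb c n" "0 \<le> cheb c (Suc n)" "0 < cheb c n \<or> 0 < cheb c (Suc n)" by auto
  qed
  show ?thesis
  proof (cases "even n")
    case True
    then show ?thesis
      using q kc(1) act_alt_word_root[OF dihedral_action[OF st(1,2) _ kc(3,4)], of n]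
      by (intro that[of "cheb c (Suc n)" "cheb c n * k"]) (auto simp: ua)
  next
    case False
    then show ?thesis
      using q kc(1) act_alt_word_root[OF dihedral_action[OF st(1,2) _ kc(3,4)], of n]
      by (intro that[of "cheb c n" "cheb c (Suc n) * k"]) (auto simp: ua add.commute)
  qed
qed

text \<open>Among the factorizations \<open>w = v u\<close> with \<open>u\<close> a word in \<open>s, t\<close> and additive lengths, one with
  \<open>v\<close> shortest makes both \<open>v s\<close> and \<open>v t\<close> longer than \<open>v\<close>.\<close>

lemma reduced_root_positive:
  assumes "reduced (w @ [s])" "s \<in> S"
  shows "act \<rho> w (\<alpha> s) \<in> PLC (\<alpha> ` S)"
  using assms
proof (induction "length w" arbitrary: w s rule: less_induct)
  case less
  have w: "reduced w" using reduced_appendD less.prems by blast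
  show ?case
  proof (cases w rule: rev_cases)
    case Nil
    then show ?thesis using less.prems by (auto intro: PLC_superset)
  next
    case (snoc w' t)
    have t: "t \<in> S" using reduced_in_lists[OF w] snoc by auto
    have "s \<noteq> t" using less.prems(1) not_reduced_double[of w' s] snoc by auto
    define good where "good v \<longleftrightarrow> (\<exists>u\<in>lists {s, t}. w \<bumpeq> v @ u \<and> length v + length u = length w)" for v
    \<comment> \<open>Splitting off just the last letter \<open>t\<close> is admissible, so the
      minimal \<open>v\<close> is strictly shorter than \<open>w\<close> and the induction
      hypothesis applies to it.\<close>
    have "good w'"
      unfolding good_def using snoc word_eq_refl[OF reduced_in_lists[OF w]]
      by (intro bexI[of _ "[t]"]) auto
    then obtain v where v: "good v" "\<forall>v'. good v' \<longrightarrow> length v \<le> length v'"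
      using ex_has_least_nat[of good w' length] by blast
    obtain u where u: "u \<in> lists {s, t}" "w \<bumpeq> v @ u" "length v + length u = length w"
      using v(1) good_def by blast
    have lv: "length v < length w" using v(2) \<open>good w'\<close> snoc by fastforce
    have rv: "reduced v" using reduced_cong[OF w u(2)] u(3) reduced_appendD(1) by simp
    have pos: "act \<rho> v (\<alpha> r) \<in> PLC (\<alpha> ` S)" if r: "r \<in> {s, t}" for r
    proof -
      have rS: "r \<in> S" using r t less.prems by auto
      have "reduced (v @ [r])"
      proof (rule ccontr)
        assume "\<not> reduced (v @ [r])"
        then obtain v' where v': "v \<bumpeq> v' @ [r]" "Suc (length v') = length v"
          using not_reduced_snocE[OF rv rS] by blast
        have "u \<in> lists S" using u(1) t less.prems by auto
        then have "v @ u \<bumpeq> (v' @ [r]) @ u" using v' by (intro word_eq_append word_eq_refl)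
        with u(2) have "w \<bumpeq> v' @ (r # u)" using word_eq_trans by fastforce
        then have "good v'"
          unfolding good_def using u v' r by (intro bexI[of _ "r # u"]) auto
        then show False using v(2) v'(2) by fastforce
      qed
      then show ?thesis using less.hyps lv rS by blast
    qed
    have "w @ [s] \<bumpeq> (v @ u) @ [s]"
      using u(2) less.prems by (intro word_eq_append word_eq_refl) auto
    then have "reduced (v @ u @ [s])"
      using reduced_cong[OF less.prems(1)] u(3) by simp
    then have "reduced (u @ [s])" by (rule reduced_appendD)
    then obtain a b where ab: "0 \<le> a" "0 \<le> b" "0 < a \<or> 0 < b"
        "act \<rho> u (\<alpha> s) = a *\<^sub>R \<alpha> s + b *\<^sub>R \<alpha> t"
      using act_dihedral_root[OF less.prems(2) t \<open>s \<noteq> t\<close> u(1)] by blast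
    have "linear (act \<rho> v)" using linear_act_rho reduced_in_lists rv by blast
    then have "act \<rho> w (\<alpha> s) = a *\<^sub>R act \<rho> v (\<alpha> s) + b *\<^sub>R act \<rho> v (\<alpha> t)"
      using act_cong[OF u(2)] ab(4) by (simp add: act_append linear_add linear_scale)
    then show ?thesis using pos ab by (auto intro: PLC_combination)
  qed
qed

section \<open>Faithfulness, the isomorphism and the splitting\<close>

lemma act_snoc_self:
  assumes "u \<in> lists S" "s \<in> S"
  shows "act \<rho> (u @ [s]) (\<alpha> s) = - act \<rho> u (\<alpha> s)"
  using rho_self[OF assms(2)] linear_act_rho[OF assms(1)] by (simp add: act_append linear_neg)

lemma PLC_not_opposite: "x \<in> PLC (\<alpha> ` S) \<Longrightarrow> - x \<notin> PLC (\<alpha> ` S)"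
  using PLC_add zero_notin_PLC by (metis add.right_inverse)

text \<open>If a nonempty reduced word \<open>w @ [s]\<close> acted as the identity, both
  \<open>act \<rho> w (\<alpha> s)\<close> and its negative, which is \<open>\<alpha> s\<close>,
  would be positive.\<close>

lemma faithful:
  assumes "u \<in> lists S" "act \<rho> u = id"
  shows "u \<bumpeq> []"
proof -
  obtain v where v: "reduced v" "u \<bumpeq> v" using ex_reduced assms(1) by blast
  show ?thesis
  proof (cases v rule: rev_cases)
    case Nil
    then show ?thesis using v by simp
  next
    case (snoc w s)
    have ws: "w \<in> lists S" "s \<in> S" using reduced_in_lists[OF v(1)] snoc by auto
    have "act \<rho> w (\<alpha> s) \<in> PLC (\<alpha> ` S)" using reduced_root_positive v(1) snoc ws by blast
    moreover have "- act \<rho> w (\<alpha> s) = \<alpha> s"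
      using act_snoc_self[OF ws] act_cong[OF v(2)] assms(2) snoc by (metis id_apply)
    ultimately show ?thesis using PLC_not_opposite PLC_superset ws(2) by (metis imageI)
  qed
qed

lemma ex_iso:
  "\<exists>h\<in>iso (coxeter_group S p \<alpha> \<beta>) W1. \<forall>s\<in>S. h (coxeter_gen S p \<alpha> \<beta> s) = \<rho> s"
proof -
  obtain h where h: "h \<in> hom (coxeter_group S p \<alpha> \<beta>) W1"
      "\<forall>s\<in>S. h (coxeter_gen S p \<alpha> \<beta> s) = \<rho> s"
      "\<forall>u\<in>lists S. h (pres_class S Rel (pos_word u)) = act \<rho> u"
    using ex_hom by blast
  interpret group_hom "coxeter_group S p \<alpha> \<beta>" W1 h
    using h(1) group_presented_group group_W1
    by (simp add: coxeter_group_def group_hom_def group_hom_axioms_def)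
  have carrier: "carrier (coxeter_group S p \<alpha> \<beta>) = (\<lambda>u. pres_class S Rel (pos_word u)) ` lists S"
  proof -
    have "pres_class S Rel x = pres_class S Rel (pos_word (map fst x)) \<and> map fst x \<in> lists S"
      if "x \<in> gwords S" for x
    proof -
      have "map fst x \<in> lists S" using that by fastforce
      then show ?thesis
        using gword_pos_word[OF that] that by (simp only: pres_class_eq_iff pos_word_in_gwords)
    qed
    then show ?thesis
      unfolding coxeter_group_def carrier_presented_group using pos_word_in_gwords by blast
  qed
  have "h \<in> iso (coxeter_group S p \<alpha> \<beta>) W1"
    unfolding iso_iff
  proof (intro conjI ballI impI subsetI)
    fix w assume "w \<in> carrier W1"
    then obtain u where "u \<in> lists S" "w = act \<rho> u" by (rule W1_eq_act)
    then show "w \<in> h ` carrier (coxeter_group S p \<alpha> \<beta>)"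
      unfolding carrier using h(3) by (metis imageI)
  next
    fix x assume "x \<in> carrier (coxeter_group S p \<alpha> \<beta>)" and one: "h x = \<one>\<^bsub>W1\<^esub>"
    then obtain u where u: "u \<in> lists S" "x = pres_class S Rel (pos_word u)"
      unfolding carrier by blast
    then have "u \<bumpeq> []" using faithful h(3) one one_W1 by metis
    then have "x = pres_class S Rel []"
      unfolding u(2) using u(1) by (subst pres_class_eq_iff) (auto simp: word_eq_def)
    then show "x = \<one>\<^bsub>coxeter_group S p \<alpha> \<beta>\<^esub>"
      by (simp add: coxeter_group_def one_presented_group)
  qed
  then show ?thesis using h(2) by blast
qed

text \<open>Let \<open>v\<close> be reduced. If \<open>v @ [s]\<close> is reduced, the root
  \<open>act \<rho> v (\<alpha> s)\<close> is positive; otherwise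
  \<open>v \<bumpeq> v' @ [s]\<close>, and the root is the negative of the positive root
  \<open>act \<rho> v' (\<alpha> s)\<close>.\<close>

lemma datum_imp_split: "roots_split S \<rho> \<alpha>"
  unfolding roots_split_def
proof (rule conjI, (rule equalityI; rule subsetI))
  fix x assume x: "x \<in> roots S \<rho> \<alpha>"
  then obtain u s where us: "u \<in> lists S" "s \<in> S" "x = act \<rho> u (\<alpha> s)" by (rule rootsE)
  obtain v where v: "reduced v" "u \<bumpeq> v" using ex_reduced us(1) by blast
  have xv: "x = act \<rho> v (\<alpha> s)" using act_cong[OF v(2)] us(3) by simp
  show "x \<in> pos_roots S \<rho> \<alpha> \<union> neg_roots S \<rho> \<alpha>"
  proof (cases "reduced (v @ [s])")
    case True
    then show ?thesis using reduced_root_positive us(2) xv x by (auto simp: pos_roots_def)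
  next
    case False
    then obtain v' where v': "v \<bumpeq> v' @ [s]" "reduced (v' @ [s])"
      using not_reduced_snocE[OF v(1) us(2)] by blast
    have vS: "v' \<in> lists S" using reduced_in_lists[OF v'(2)] by simp
    have "x = - act \<rho> v' (\<alpha> s)"
      using act_cong[OF v'(1)] act_snoc_self[OF vS us(2)] xv by simp
    moreover have "act \<rho> v' (\<alpha> s) \<in> pos_roots S \<rho> \<alpha>"
      using reduced_root_positive[OF v'(2) us(2)] act_root[OF vS us(2)] by (simp add: pos_roots_def)
    ultimately show ?thesis by (auto simp: neg_roots_def)
  qed
next
  fix x assume "x \<in> pos_roots S \<rho> \<alpha> \<union> neg_roots S \<rho> \<alpha>"
  then show "x \<in> roots S \<rho> \<alpha>"
  proof
    assume "x \<in> neg_roots S \<rho> \<alpha>"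
    then obtain y where "y \<in> roots S \<rho> \<alpha>" "x = - y"
      by (auto simp: neg_roots_def pos_roots_def)
    then obtain u s where us: "u \<in> lists S" "s \<in> S" "x = - act \<rho> u (\<alpha> s)"
      by (metis rootsE)
    then have "x = act \<rho> (u @ [s]) (\<alpha> s)" using act_snoc_self by simp
    then show ?thesis using act_root[of "u @ [s]" s] us by simp
  qed (simp add: pos_roots_def)
next
  show "pos_roots S \<rho> \<alpha> \<inter> neg_roots S \<rho> \<alpha> = {}"
    using PLC_not_opposite by (auto simp: pos_roots_def neg_roots_def)
qed

end

section \<open>Both spaces together\<close>

text \<open>Exchanging the two sides inverts the scale \<open>k\<close> and keeps
  \<open>c\<close>.\<close>

lemma coxeter_datum_flip:
  assumes "coxeter_datum S p \<alpha> \<beta>"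
  shows "coxeter_datum S (\<lambda>y x. p x y) \<beta> \<alpha>"
  unfolding coxeter_datum_def
proof (intro ballI impI)
  fix s t assume "s \<in> S" "t \<in> S" "s \<noteq> t"
  then obtain k c where "0 < k" "0 \<le> c" "p (\<alpha> s) (\<beta> t) = - (c * k)" "p (\<alpha> t) (\<beta> s) = - (c / k)"
      "1 \<le> c \<or> (\<exists>m\<ge>2. c = cos (pi / real m))"
    using assms unfolding coxeter_datum_def by blast
  then show "\<exists>k>0. \<exists>c\<ge>0. p (\<alpha> t) (\<beta> s) = - (c * k) \<and> p (\<alpha> s) (\<beta> t) = - (c / k) \<and>
      (1 \<le> c \<or> (\<exists>m\<ge>2. c = cos (pi / real m)))"
    by (intro exI[of _ "1 / k"] conjI exI[of _ c]) auto
qed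

text \<open>The relators see only the product of the two mixed pairings, so both spaces lead to the
  same abstract group.\<close>

lemma coxeter_relators_flip:
  "coxeter_relators S (\<lambda>y x. p x y) \<beta> \<alpha> = coxeter_relators S p \<alpha> \<beta>"
  unfolding coxeter_relators_def by (simp only: mult.commute)

lemma rho1_flip: "rho1 (\<lambda>y x. p x y) \<beta> \<alpha> = rho2 p \<alpha> \<beta>"
  by (simp add: rho1_def rho2_def fun_eq_iff)

theorem theorem2p8:
  fixes S :: "'s set"
    and p :: "'v::real_vector \<Rightarrow> 'w::real_vector \<Rightarrow> real"
    and \<alpha> :: "'s \<Rightarrow> 'v" and \<beta> :: "'s \<Rightarrow> 'w"
  assumes "bilinear p"
    and "inj_on \<alpha> S" and "inj_on \<beta> S"
    and "\<forall>s\<in>S. p (\<alpha> s) (\<beta> s) = 1"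
    and "0 \<notin> PLC (\<alpha> ` S)" and "0 \<notin> PLC (\<beta> ` S)"
    and "\<forall>s\<in>S. \<alpha> s \<notin> PLC (\<alpha> ` S - {\<alpha> s})"
    and "\<forall>s\<in>S. \<beta> s \<notin> PLC (\<beta> ` S - {\<beta> s})"
  shows "(roots_split S (rho1 p \<alpha> \<beta>) \<alpha> \<longleftrightarrow> roots_split S (rho2 p \<alpha> \<beta>) \<beta>) \<and>
    (roots_split S (rho1 p \<alpha> \<beta>) \<alpha> \<longrightarrow>
      (\<exists>f1 \<in> iso (coxeter_group S p \<alpha> \<beta>) (refl_group S (rho1 p \<alpha> \<beta>)).
       \<exists>f2 \<in> iso (coxeter_group S p \<alpha> \<beta>) (refl_group S (rho2 p \<alpha> \<beta>)).
         \<forall>s\<in>S. f1 (coxeter_gen S p \<alpha> \<beta> s) = rho1 p \<alpha> \<beta> s \<and>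
               f2 (coxeter_gen S p \<alpha> \<beta> s) = rho2 p \<alpha> \<beta> s))"
proof -
  let ?q = "\<lambda>y x. p x y"
  interpret V1: root_pairing S p \<alpha> \<beta>
    using assms by unfold_locales auto
  have "bilinear ?q" using assms(1) by (simp add: bilinear_def)
  then interpret V2: root_pairing S ?q \<beta> \<alpha>
    using assms by unfold_locales auto
  note V2_split_imp_datum = V2.split_imp_datum[unfolded rho1_flip]
  have 1: "coxeter_pairing S p \<alpha> \<beta>" and 2: "coxeter_pairing S ?q \<beta> \<alpha>"
    if "coxeter_datum S p \<alpha> \<beta>"
    using that coxeter_datum_flip[OF that] by unfold_locales
  have split: "roots_split S (rho1 p \<alpha> \<beta>) \<alpha> \<and> roots_split S (rho2 p \<alpha> \<beta>) \<beta>"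
    if "coxeter_datum S p \<alpha> \<beta>"
    using coxeter_pairing.datum_imp_split[OF 1[OF that]]
      coxeter_pairing.datum_imp_split[OF 2[OF that]] by (simp add: rho1_flip)
  \<comment> \<open>Each splitting is equivalent to the datum, which is symmetric in the two
    spaces.\<close>
  have "roots_split S (rho1 p \<alpha> \<beta>) \<alpha> \<longleftrightarrow> roots_split S (rho2 p \<alpha> \<beta>) \<beta>"
    using split V1.split_imp_datum coxeter_datum_flip[OF V2_split_imp_datum] by blast
  moreover have "\<exists>f1 \<in> iso (coxeter_group S p \<alpha> \<beta>) (refl_group S (rho1 p \<alpha> \<beta>)).
       \<exists>f2 \<in> iso (coxeter_group S p \<alpha> \<beta>) (refl_group S (rho2 p \<alpha> \<beta>)).
         \<forall>s\<in>S. f1 (coxeter_gen S p \<alpha> \<beta> s) = rho1 p \<alpha> \<beta> s \<and>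
               f2 (coxeter_gen S p \<alpha> \<beta> s) = rho2 p \<alpha> \<beta> s"
    if "roots_split S (rho1 p \<alpha> \<beta>) \<alpha>"
  proof -
    have d: "coxeter_datum S p \<alpha> \<beta>" using that by (rule V1.split_imp_datum)
    \<comment> \<open>\<open>f2\<close> is the isomorphism for the flipped pairing, with source and
      target rewritten by the flip lemmas.\<close>
    show ?thesis
      using coxeter_pairing.ex_iso[OF 1[OF d]] coxeter_pairing.ex_iso[OF 2[OF d]]
      unfolding rho1_flip[of p] coxeter_group_def coxeter_gen_def coxeter_relators_flip[of S p]
      by blast
  qed
  ultimately show ?thesis by blast
qed

end
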